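(* Let $\rho\in(-1,1)$ and let $(X,Y)$ be a bivariate random vector with $$(X,Y)\stackrel{d}{=}(RI_1W,\ \rho RI_1W+RI_2z^*(W)),$$ where $(I_1,I_2)$, $R>0$ and $W\in(0,1)$ are mutually independent, $I_1,I_2$ take values in $\{-1,1\}$ with $P\{I_1=I_2=1\}\in(0,1]$, $z^*:[0,1]\to[0,1]$ is a positive measurable function, $R$ has distribution function $F$ with infinite upper endpoint, and the distribution function of $W$ has upper endpoint $1$. Let $a\in(0,1]$ be a constant and put $z(x):=\rho x+z^*(x)$, $x\in[0,1]$. Suppose that there exists $a_\rho\in(1,a/|\rho|)$ such that for some $\varepsilon\in(0,1)$ the function $z$ is decreasing in $V_\varepsilon:=[1/a_\rho-\varepsilon,\,1/a_\rho+\varepsilon]$, and $z(x)\le a/a_\rho$ for all $x\in(1/a_\rho,1]$. Suppose that the inverse $z_\varepsilon$ of $z$ in $V_\varepsilon$ satisfies, as $x\to\infty$, $$z_\varepsilon(a/a_\rho-d/x)-1/a_\rho\ \sim\ \frac{cd}{x}$$ locally uniformly for $d>0$, with some $c\in(0,\infty)$. Suppose further that $F\in GMDA(w)$ for some positive scaling function $w$ and that, with $K_1:=-1/a_\rho$ and $K_2:=ca/a_\rho$, $$P\{W-1/a_\rho\in(K_1u,K_2u)\}\ \sim\ L_{K_1,K_2}(u)\,u^{\gamma_a},\qquad u\downarrow0,$$ for some $\gamma_a\in[0,\infty)$ and some locally bounded function $L_{K_1,K_2}(u)$, $u>0$, slowly varying at $0$. Then $a_\rho$ is unique and, as $x\to\infty$,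 $$P\{X>x,\ Y>ax\}\ \sim\ P\{I_1=I_2=1\}\,\Gamma(\gamma_a+1)\,L_{K_1,K_2}(1/v(x_* ))\,\frac{\overline F(x_* )}{(v(x_* ))^{\gamma_a}},$$ where $x_*:=a_\rho x$ and $v(x):=xw(x)$, $x>0$.
   Context: $\overline F:=1-F$. $F\in GMDA(w)$, for $F$ with infinite upper endpoint, means $\lim_{x\to\infty}\overline F(x+t/w(x))/\overline F(x)=e^{-t}$ for all $t\in\mathbb R$. $f\sim g$ means that the ratio $f/g$ tends to $1$ in the indicated limit. If $\rho=0$, $a/|\rho|$ is read as $+\infty$. $\Gamma$ is the Euler gamma function. $\stackrel{d}{=}$ denotes equality in distribution.
   Formalization: The formal theorem also assumes that the supremum of z over (1/a_ρ+ε, 1] is strictly less than a/a_ρ; without it the claim fails, e.g. for ρ=0, a=1, a_ρ=2, I_1=I_2=1, R exponential, W uniform, z*(x)=1-x on [0,4/5] and 1/2 on (4/5,1]. *)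

theory Defs
  imports "HOL-Probability.Probability" "HOL-Library.Landau_Symbols"
begin

definition upper_endpoint :: "(real \<Rightarrow> real) \<Rightarrow> ereal" where
  "upper_endpoint G = Sup {ereal x | x. G x < 1}"

(* Only meaningful for distribution functions with infinite upper endpoint. *)
definition GMDA :: "(real \<Rightarrow> real) \<Rightarrow> (real \<Rightarrow> real) \<Rightarrow> bool" where
  "GMDA F w \<longleftrightarrow>
     (\<forall>t. ((\<lambda>x. (1 - F (x + t / w x)) / (1 - F x)) \<longlongrightarrow> exp (- t)) at_top)"

(* Measurability of L is not required. *)
definition slowly_varying_at_0 :: "(real \<Rightarrow> real) \<Rightarrow> bool" where
  "slowly_varying_at_0 L \<longleftrightarrow>
     (\<forall>\<^sub>F u in at_right 0. L u > 0) \<and>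
     (\<forall>t>0. ((\<lambda>u. L (t * u) / L u) \<longlongrightarrow> 1) (at_right 0))"

definition locally_bounded_on :: "real set \<Rightarrow> (real \<Rightarrow> real) \<Rightarrow> bool" where
  "locally_bounded_on S L \<longleftrightarrow> (\<forall>K. compact K \<and> K \<subseteq> S \<longrightarrow> bounded (L ` K))"

definition rv_events :: "'a measure \<Rightarrow> ('a \<Rightarrow> 'b::topological_space) \<Rightarrow> 'a set set" where
  "rv_events N f = {f -` A \<inter> space N | A. A \<in> sets borel}"

definition zfun :: "real \<Rightarrow> (real \<Rightarrow> real) \<Rightarrow> real \<Rightarrow> real" where
  "zfun \<rho> zs x = \<rho> * x + zs x"

definition V :: "real \<Rightarrow> real \<Rightarrow> real set" where
  "V ar \<epsilon> = {1 / ar - \<epsilon> .. 1 / ar + \<epsilon>}"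

(* The range condition ar < a / |\<rho>| is void for \<rho> = 0.  Since zfun is meant as a function
   on [0,1], V is required to lie there.  "Decreasing" is strict because the inverse of zfun
   on V is used; the_inv_into is unspecified off the image of V, so that its arguments lie in
   the image is stated explicitly. *)
definition admissible ::
  "real \<Rightarrow> real \<Rightarrow> (real \<Rightarrow> real) \<Rightarrow> real \<Rightarrow> real \<Rightarrow> real \<Rightarrow> bool" where
  "admissible a \<rho> zs ar \<epsilon> c \<longleftrightarrow>
     1 < ar \<and> (\<rho> \<noteq> 0 \<longrightarrow> ar < a / \<bar>\<rho>\<bar>) \<and>
     0 < \<epsilon> \<and> \<epsilon> < 1 \<and> V ar \<epsilon> \<subseteq> {0..1} \<and>
     strict_antimono_on (V ar \<epsilon>) (zfun \<rho> zs) \<and>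
     (\<forall>x\<in>{1 / ar<..1}. zfun \<rho> zs x \<le> a / ar) \<and>
     0 < c \<and>
     (\<forall>K. compact K \<and> K \<subseteq> {0<..} \<longrightarrow>
        (\<forall>\<^sub>F x in at_top. \<forall>d\<in>K. a / ar - d / x \<in> zfun \<rho> zs ` V ar \<epsilon>) \<and>
        uniform_limit K
          (\<lambda>x d. (the_inv_into (V ar \<epsilon>) (zfun \<rho> zs) (a / ar - d / x) - 1 / ar) / (c * d / x))
          (\<lambda>_. 1) at_top)"

(* The bound zfun \<le> a / ar in admissible does not prevent zfun from returning to the level
   a / ar to the right of V.  The tail asymptotics then fail: for I1 = I2 = 1, \<rho> = 0, a = 1,
   R standard exponential, W uniform on (0,1), zs x = 1 - x for x \<le> 4/5 and zs x = 1/2 for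
   x > 4/5, the number ar = 2 is admissible (c = 1), but P(X > x, Y > x) \<ge> P(R > 2x) / 5,
   whereas the formula would give P(R > 2x) / (2x). *)
definition separated_beyond ::
  "real \<Rightarrow> real \<Rightarrow> (real \<Rightarrow> real) \<Rightarrow> real \<Rightarrow> real \<Rightarrow> bool" where
  "separated_beyond a \<rho> zs ar \<epsilon> \<longleftrightarrow>
     (\<exists>s < a / ar. \<forall>x\<in>{1 / ar + \<epsilon><..1}. zfun \<rho> zs x \<le> s)"

end

theory Submission
  imports Defs
begin

text \<open>Put $p = 1/a_\rho$, $S = 1 - F$ and $y = a_\rho x$. On $I_1 = I_2 = 1$ the event
  $X > x$, $Y > ax$ says $W > p(1-\tau)$ and $z(W) > ap(1-\tau)$ with $\tau = 1 - y/R$. Its probability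
  given $R$ is $H(\tau)$, where $H$ is nondecreasing, vanishes for $\tau \le 0$, and is regularly
  varying at $0$ with index $\gamma$, because for small $\tau$ the event reads
  $W - p \in (K_1 \tau, K_2 \tau (1 + o(1)))$. By $F \in GMDA(w)$, $(R - y) w(y)$ given $R > y$
  converges in law to a standard exponential variable $T$, so
  $E[H(1 - y/R); R > y] \sim S(y) H(1/v(y)) E[T^\gamma]$. Uniform integrability comes from a
  polynomial bound on $S(y + t/w(y))/S(y)$ and a Potter bound for $H$. The case $I_1 = 1$, $I_2 = -1$
  forces $R > k y$ for some $k > 1$, and $S(ky)/S(y)$ decays faster than any power of $v(y)$.\<close>

section \<open>Tails in the Gumbel domain of attraction\<close>

lemma between_powers:
  fixes b x :: real
  assumes "1 < b" "1 \<le> x"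
  obtains k where "b ^ k \<le> x" "x < b ^ (k + 1)"
proof -
  define n where "n = (LEAST n. x < b ^ n)"
  have n: "x < b ^ n"
    unfolding n_def by (rule LeastI_ex) (use real_arch_pow[OF assms(1)] in blast)
  with assms(2) obtain k where k: "n = Suc k" by (cases n) auto
  then have "\<not> x < b ^ k" using not_less_Least[of k "\<lambda>n. x < b ^ n"] by (simp add: n_def)
  with n k that[of k] show thesis by simp
qed

lemma exp_1_gt_2: "2 < exp (1::real)"
  using exp_less_mono[OF ln_2_less_1] by simp

text \<open>The survival function of a strictly positive variable with infinite upper endpoint:
  positivity everywhere encodes the endpoint, and the value 1 on the nonpositive axis encodes
  \<open>R > 0\<close>.\<close>

locale gumbel_tail =
  fixes S w :: "real \<Rightarrow> real"
  assumes S_antimono: "x \<le> y \<Longrightarrow> S y \<le> S x"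
    and S_pos: "0 < S x"
    and S_nonpos: "x \<le> 0 \<Longrightarrow> S x = 1"
    and S_tendsto_0: "(S \<longlongrightarrow> 0) at_top"
    and w_pos: "0 < x \<Longrightarrow> 0 < w x"
    and S_limit: "((\<lambda>x. S (x + t / w x) / S x) \<longlongrightarrow> exp (- t)) at_top"
begin

text \<open>If \<open>x * w x < C\<close>, then the shift by \<open>- C / w x\<close> lands on the
  nonpositive axis, where \<open>S\<close> is 1. The ratio at \<open>t = - C\<close> is then
  \<open>1 / S x\<close>, which is unbounded, whereas its limit is \<open>exp C\<close>.\<close>

lemma v_at_top: "filterlim (\<lambda>x. x * w x) at_top at_top"
proof (rule filterlim_at_top_gt[where c = 0, THEN iffD2], intro allI impI)
  fix C :: real assume "0 < C"
  have "\<forall>\<^sub>F x in at_top. S (x + - C / w x) / S x < exp C + 1"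
    using order_tendstoD(2)[OF S_limit[of "- C"], of "exp C + 1"] by simp
  moreover have "\<forall>\<^sub>F x in at_top. S x < 1 / (exp C + 1)"
    by (rule order_tendstoD(2)[OF S_tendsto_0]) (simp add: add_pos_pos)
  ultimately show "\<forall>\<^sub>F x in at_top. C \<le> x * w x"
    using eventually_gt_at_top[of 0]
  proof eventually_elim
    case (elim x)
    show ?case
    proof (rule ccontr)
      assume "\<not> C \<le> x * w x"
      then have "S (x + - C / w x) = 1"
        using w_pos[OF elim(3)] by (intro S_nonpos) (simp add: field_simps)
      then have "1 / S x < exp C + 1" using elim(1) by simp
      moreover have "exp C + 1 < 1 / S x"
        using elim(2) S_pos[of x] exp_gt_zero[of C] by (simp add: field_simps add_pos_pos)
      ultimately show False by simp
    qed
  qed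
qed

lemma shift_at_top:
  assumes "0 \<le> t"
  shows "filterlim (\<lambda>x. x + t / w x) at_top at_top"
  by (rule filterlim_at_top_mono[OF filterlim_ident])
    (use assms w_pos in \<open>auto intro!: eventually_mono[OF eventually_gt_at_top[of 0]] simp: less_imp_le\<close>)

text \<open>If \<open>w\<close> fell by more than the factor \<open>1 + \<eta>\<close>, two
  successive steps of length 1/w would pass \<open>x + (2 + \<eta>) / w x\<close>. The two steps
  cost a factor tending to \<open>exp (- 2)\<close>, the direct shift one tending to
  \<open>exp (- 2 - \<eta>)\<close>; the level \<open>exp (- 2 - \<eta> / 2)\<close> separates
  them.\<close>

lemma scale_step:
  assumes "0 < \<eta>"
  shows "\<forall>\<^sub>F x in at_top. w x \<le> (1 + \<eta>) * w (x + 1 / w x)"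
proof -
  define y where "y = (\<lambda>x. x + 1 / w x)"
  have y: "filterlim y at_top at_top" unfolding y_def by (rule shift_at_top) simp
  have "((\<lambda>x. S (y x + 1 / w (y x)) / S (y x)) \<longlongrightarrow> exp (- 1)) at_top"
    by (rule filterlim_compose[OF S_limit y])
  from tendsto_mult[OF this S_limit[of 1]]
  have "((\<lambda>x. S (y x + 1 / w (y x)) / S (y x) * (S (x + 1 / w x) / S x)) \<longlongrightarrow> exp (- 2)) at_top"
    by (simp flip: exp_add)
  then have "\<forall>\<^sub>F x in at_top. exp (- 2 - \<eta> / 2) <
      S (y x + 1 / w (y x)) / S (y x) * (S (x + 1 / w x) / S x)"
    by (rule order_tendstoD) (use assms in simp)
  moreover have "\<forall>\<^sub>F x in at_top. S (x + (2 + \<eta>) / w x) / S x < exp (- 2 - \<eta> / 2)"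
    by (rule order_tendstoD[OF S_limit]) (use assms in simp)
  ultimately show ?thesis
    using eventually_gt_at_top[of 0]
  proof eventually_elim
    case (elim x)
    have wx: "0 < w x" using w_pos elim by simp
    then have "0 < y x" using elim by (simp add: y_def add_pos_pos)
    then have wy: "0 < w (y x)" using w_pos by simp
    show ?case
    proof (rule ccontr)
      assume "\<not> ?case"
      then have "(1 + \<eta>) / w x \<le> 1 / w (y x)"
        using wx wy by (simp add: y_def field_simps)
      then have "x + (2 + \<eta>) / w x \<le> y x + 1 / w (y x)"
        by (simp add: y_def add_divide_distrib)
      then have "S (y x + 1 / w (y x)) \<le> S (x + (2 + \<eta>) / w x)"
        by (rule S_antimono)
      moreover have "S (y x + 1 / w (y x)) / S (y x) * (S (x + 1 / w x) / S x) = S (y x + 1 / w (y x)) / S x"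
        using S_pos[of "y x"] by (simp add: y_def)
      ultimately show False
        using elim S_pos[of x] by (smt (verit) divide_right_mono)
    qed
  qed
qed

text \<open>The points reached by $k$ steps of length $1/w$ grow at most geometrically with ratio
  $1 + \eta$, while each step at least halves $S$; a small $\eta$ gives any polynomial rate.\<close>

lemma polynomial_tail_bound:
  "\<exists>\<eta>>0. \<forall>\<^sub>F x in at_top. \<forall>t\<ge>0. S (x + t / w x) * (1 + \<eta> * t) ^ m \<le> 2 * S x"
proof -
  \<comment> \<open>The rate \<open>\<eta>\<close> is chosen so that one more step raises the
    polynomial weight by less than the factor 2 that \<open>S\<close> loses.\<close>
  have "((\<lambda>\<eta>::real. (1 + \<eta>) ^ m) \<longlongrightarrow> (1 + 0) ^ m) (at_right 0)"
    by (intro tendsto_intros)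
  then have "\<forall>\<^sub>F \<eta> in at_right 0. (1 + \<eta>::real) ^ m < 2"
    by (rule order_tendstoD) simp
  then have "\<forall>\<^sub>F \<eta> in at_right 0. (1 + \<eta>::real) ^ m < 2 \<and> 0 < \<eta>"
    using eventually_at_right_less by eventually_elim simp
  then obtain \<eta> :: real where \<eta>: "(1 + \<eta>) ^ m < 2" "0 < \<eta>"
    using eventually_happens'[OF trivial_limit_at_right_real] by blast
  have "\<forall>\<^sub>F x in at_top. S (x + 1 / w x) / S x < 1 / 2"
    by (rule order_tendstoD[OF S_limit]) (use exp_1_gt_2 in \<open>simp add: exp_minus field_simps\<close>)
  then have "\<forall>\<^sub>F x in at_top. S (x + 1 / w x) \<le> S x / 2"
    by eventually_elim (use S_pos in \<open>simp add: field_simps less_imp_le\<close>)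
  then have "\<forall>\<^sub>F x in at_top. S (x + 1 / w x) \<le> S x / 2 \<and> w x \<le> (1 + \<eta>) * w (x + 1 / w x) \<and> 0 < x"
    using scale_step[OF \<eta>(2)] eventually_gt_at_top[of 0] by eventually_elim simp
  then obtain x0 where x0: "\<And>x. x0 \<le> x \<Longrightarrow>
      S (x + 1 / w x) \<le> S x / 2 \<and> w x \<le> (1 + \<eta>) * w (x + 1 / w x) \<and> 0 < x"
    by (auto simp: eventually_at_top_linorder)
  \<comment> \<open>\<open>((1 + \<eta>) ^ k - 1) / \<eta>\<close> is the geometric sum of the
    powers of \<open>1 + \<eta>\<close> with exponents below \<open>k\<close>. In units of
    \<open>1 / w x\<close> it bounds the total length of \<open>k\<close> steps, each at most
    \<open>1 + \<eta>\<close> times as long as the one before.\<close>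
  have iter: "S (x + (((1 + \<eta>) ^ k - 1) / \<eta>) / w x) \<le> S x / 2 ^ k" if "x0 \<le> x" for x k
    using that
  proof (induction k arbitrary: x)
    case (Suc k)
    define y where "y = x + 1 / w x"
    define s where "s = ((1 + \<eta>) ^ k - 1) / \<eta>"
    have s: "0 \<le> s" using \<eta> by (simp add: s_def)
    have wx: "0 < w x" using x0[OF Suc.prems] w_pos by simp
    then have xy: "x \<le> y" by (simp add: y_def)
    then have "0 < y" using x0[OF Suc.prems] by simp
    then have wy: "0 < w y" by (rule w_pos)
    have "1 / w y \<le> (1 + \<eta>) / w x"
      using x0[OF Suc.prems] wx wy by (simp add: y_def field_simps)
    from mult_left_mono[OF this s]
    have "s / w y \<le> (1 + \<eta>) * s / w x" by (simp add: mult.commute)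
    then have "y + s / w y \<le> x + (1 + (1 + \<eta>) * s) / w x"
      by (simp add: y_def add_divide_distrib)
    moreover have "1 + (1 + \<eta>) * s = ((1 + \<eta>) ^ Suc k - 1) / \<eta>"
      using \<eta> by (simp add: s_def field_simps)
    ultimately have "S (x + (((1 + \<eta>) ^ Suc k - 1) / \<eta>) / w x) \<le> S (y + s / w y)"
      using S_antimono by simp
    also have "\<dots> \<le> S y / 2 ^ k"
      using Suc.IH[of y] Suc.prems xy by (simp add: s_def)
    also have "\<dots> \<le> S x / 2 / 2 ^ k"
      using x0[OF Suc.prems] by (intro divide_right_mono) (auto simp: y_def)
    finally show ?case by simp
  qed simp
  have "S (x + t / w x) * (1 + \<eta> * t) ^ m \<le> 2 * S x" if x: "x0 \<le> x" and t: "0 \<le> t" for x t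
  proof -
    have "1 \<le> 1 + \<eta> * t" using \<eta> t by simp
    then obtain k where k: "(1 + \<eta>) ^ k \<le> 1 + \<eta> * t" "1 + \<eta> * t < (1 + \<eta>) ^ (k + 1)"
      using between_powers[of "1 + \<eta>" "1 + \<eta> * t"] \<eta> by auto
    have "((1 + \<eta>) ^ k - 1) / \<eta> \<le> t" using k \<eta> by (simp add: field_simps)
    then have "((1 + \<eta>) ^ k - 1) / \<eta> / w x \<le> t / w x"
      using w_pos x0[OF x] by (intro divide_right_mono) (auto simp: less_imp_le)
    then have "S (x + t / w x) \<le> S x / 2 ^ k"
      using iter[OF x, of k] S_antimono by (smt (verit))
    \<comment> \<open>There are \<open>k + 1\<close> factors below 2 against \<open>k\<close>
      halvings of \<open>S\<close>; the surplus is the constant 2 in the bound.\<close>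
    moreover have "(1 + \<eta> * t) ^ m \<le> 2 * 2 ^ k"
    proof -
      have "(1 + \<eta> * t) ^ m \<le> ((1 + \<eta>) ^ (k + 1)) ^ m"
        using k \<eta> t by (intro power_mono) auto
      also have "\<dots> = ((1 + \<eta>) ^ m) ^ (k + 1)"
        by (simp only: power_mult[symmetric] mult.commute)
      also have "\<dots> \<le> 2 ^ (k + 1)" using \<eta> by (intro power_mono) auto
      finally show ?thesis by simp
    qed
    ultimately have "S (x + t / w x) * (1 + \<eta> * t) ^ m \<le> S x / 2 ^ k * (2 * 2 ^ k)"
      using \<eta> t S_pos[of x] by (intro mult_mono) auto
    then show ?thesis by simp
  qed
  then have "\<forall>\<^sub>F x in at_top. \<forall>t\<ge>0. S (x + t / w x) * (1 + \<eta> * t) ^ m \<le> 2 * S x"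
    by (auto intro!: eventually_mono[OF eventually_ge_at_top[of x0]])
  then show ?thesis using \<eta>(2) by blast
qed

text \<open>The point \<open>r * x\<close> is \<open>x + t / w x\<close> with
  \<open>t = (r - 1) * (x * w x)\<close>. The polynomial bound with exponent \<open>Suc m\<close>
  instead of \<open>m\<close> leaves a spare factor 1/v, which tends to 0.\<close>

lemma rapid_variation:
  assumes "1 < r"
  shows "((\<lambda>x. S (r * x) / S x * (x * w x) ^ m) \<longlongrightarrow> 0) at_top"
proof -
  obtain \<eta> where \<eta>: "0 < \<eta>"
    "\<forall>\<^sub>F x in at_top. \<forall>t\<ge>0. S (x + t / w x) * (1 + \<eta> * t) ^ Suc m \<le> 2 * S x"
    using polynomial_tail_bound by blast
  define \<kappa> where "\<kappa> = \<eta> * (r - 1)"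
  have \<kappa>: "0 < \<kappa>" using assms \<eta> by (simp add: \<kappa>_def)
  have "((\<lambda>x. 2 / \<kappa> ^ Suc m / (x * w x)) \<longlongrightarrow> 0) at_top"
    by (rule real_tendsto_divide_at_top[OF tendsto_const v_at_top])
  moreover have "\<forall>\<^sub>F x in at_top. norm (S (r * x) / S x * (x * w x) ^ m) \<le> 2 / \<kappa> ^ Suc m / (x * w x)"
    using \<eta>(2) eventually_gt_at_top[of 0]
  proof eventually_elim
    case (elim x)
    define v where "v = x * w x"
    have v: "0 < v" using elim w_pos by (simp add: v_def)
    have "x + ((r - 1) * v) / w x = r * x"
      using w_pos[OF elim(2)] by (simp add: v_def field_simps)
    moreover have "0 \<le> (r - 1) * v" using assms v by simp
    ultimately have "S (r * x) * (1 + \<eta> * ((r - 1) * v)) ^ Suc m \<le> 2 * S x"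
      using elim(1) by metis
    moreover have "(\<kappa> * v) ^ Suc m \<le> (1 + \<eta> * ((r - 1) * v)) ^ Suc m"
      using \<kappa> v by (intro power_mono) (auto simp: \<kappa>_def)
    ultimately have "S (r * x) * (\<kappa> * v) ^ Suc m \<le> 2 * S x"
      using S_pos[of "r * x"] by (smt (verit) mult_left_mono)
    then have "S (r * x) / S x * v ^ m \<le> 2 / \<kappa> ^ Suc m / v"
      using S_pos[of x] \<kappa> v by (simp add: field_simps power_mult_distrib)
    moreover have "0 \<le> S (r * x) / S x * v ^ m"
      using S_pos[of x] S_pos[of "r * x"] v by simp
    ultimately show ?case by (simp add: v_def)
  qed
  ultimately show ?thesis by (rule Lim_null_comparison[rotated])
qed

end

section \<open>Monotone regularly varying functions\<close>

text \<open>Monotonicity replaces the uniform convergence theorem for regularly varying functions,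
  which would require measurability.\<close>

locale mono_regvar =
  fixes G :: "real \<Rightarrow> real" and \<gamma> :: real
  assumes G_mono: "s \<le> t \<Longrightarrow> G s \<le> G t"
    and G_pos: "0 < t \<Longrightarrow> 0 < G t"
    and G_le_1: "G t \<le> 1"
    and G_regvar: "0 < t \<Longrightarrow> ((\<lambda>u. G (t * u) / G u) \<longlongrightarrow> t powr \<gamma>) (at_right 0)"
begin

text \<open>A constant \<open>s\<close> on either side of \<open>t\<close> eventually bounds
  \<open>\<sigma>\<close>, so monotonicity transfers the known limit at \<open>s\<close>; continuity
  of the power function allows \<open>s\<close> to be as close to \<open>t\<close> as the tolerance
  requires.\<close>

lemma locally_uniform:
  assumes u: "filterlim u (at_right 0) A" and \<sigma>: "(\<sigma> \<longlongrightarrow> t) A" and t: "0 < t"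
  shows "((\<lambda>x. G (\<sigma> x * u x) / G (u x)) \<longlongrightarrow> t powr \<gamma>) A"
proof (rule order_tendstoI)
  have u0: "\<forall>\<^sub>F x in A. 0 < u x"
    using u eventually_at_right_less[of "0::real"] by (rule eventually_compose_filterlim[rotated])
  have cont: "((\<lambda>s. s powr \<gamma>) \<longlongrightarrow> t powr \<gamma>) (at t)"
    using t by (intro tendsto_intros) auto
  fix b assume b: "t powr \<gamma> < b"
  have "\<forall>\<^sub>F s in at_right t. s powr \<gamma> < b \<and> t < s"
    using order_tendstoD(2)[OF tendsto_within_subset[OF cont] b] eventually_at_right_less[of t]
    by (auto intro: eventually_conj)
  then obtain s where s: "s powr \<gamma> < b" "t < s"
    using eventually_happens'[OF trivial_limit_at_right_real] by blast
  have "\<forall>\<^sub>F x in A. G (s * u x) / G (u x) < b"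
    by (rule order_tendstoD[OF filterlim_compose[OF G_regvar u]]) (use s t in auto)
  then show "\<forall>\<^sub>F x in A. G (\<sigma> x * u x) / G (u x) < b"
    using order_tendstoD(2)[OF \<sigma> s(2)] order_tendstoD(1)[OF \<sigma> t] u0
  proof eventually_elim
    case (elim x)
    then have "G (\<sigma> x * u x) \<le> G (s * u x)" by (intro G_mono) auto
    then show ?case using elim G_pos[of "u x"] by (smt (verit) divide_right_mono)
  qed
next
  have u0: "\<forall>\<^sub>F x in A. 0 < u x"
    using u eventually_at_right_less[of "0::real"] by (rule eventually_compose_filterlim[rotated])
  have cont: "((\<lambda>s. s powr \<gamma>) \<longlongrightarrow> t powr \<gamma>) (at t)"
    using t by (intro tendsto_intros) auto
  fix b assume b: "b < t powr \<gamma>"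
  have "\<forall>\<^sub>F s in at_left t. b < s powr \<gamma> \<and> s \<in> {0<..<t}"
    using order_tendstoD(1)[OF tendsto_within_subset[OF cont] b] eventually_at_left_real[OF t]
    by (auto intro: eventually_conj)
  then obtain s where s: "b < s powr \<gamma>" "0 < s" "s < t"
    using eventually_happens'[OF trivial_limit_at_left_real] by fastforce
  have "\<forall>\<^sub>F x in A. b < G (s * u x) / G (u x)"
    by (rule order_tendstoD[OF filterlim_compose[OF G_regvar u]]) (use s in auto)
  then show "\<forall>\<^sub>F x in A. b < G (\<sigma> x * u x) / G (u x)"
    using order_tendstoD(1)[OF \<sigma> s(3)] u0
  proof eventually_elim
    case (elim x)
    then have "G (s * u x) \<le> G (\<sigma> x * u x)" using s by (intro G_mono) auto
    then show ?case using elim G_pos[of "u x"] by (smt (verit) divide_right_mono)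
  qed
qed

text \<open>Near 0 a doubling of the argument multiplies \<open>G\<close> by less than
  \<open>2 ^ q\<close>, because \<open>q > \<gamma>\<close>. Iterated doubling gives the bound as
  long as \<open>T * u\<close> stays below \<open>u0\<close>; beyond that, \<open>G \<le> 1\<close>
  takes over.\<close>

lemma potter:
  "\<exists>u0>0. \<exists>C>0. \<exists>q. \<forall>u T. 0 < u \<longrightarrow> u \<le> u0 \<longrightarrow> 1 \<le> T \<longrightarrow> G (T * u) \<le> C * T ^ q * G u"
proof -
  obtain q :: nat where q: "\<gamma> < q" using reals_Archimedean2 by blast
  have "2 powr \<gamma> < (2::real) ^ q" using q by (simp flip: powr_realpow)
  then have "\<forall>\<^sub>F u in at_right 0. G (2 * u) / G u < 2 ^ q"
    by (intro order_tendstoD[OF G_regvar]) auto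
  then obtain u1 where u1: "0 < u1" "\<And>u. 0 < u \<Longrightarrow> u < u1 \<Longrightarrow> G (2 * u) / G u < 2 ^ q"
    by (auto simp: eventually_at_right[OF zero_less_one])
  define u0 where "u0 = u1 / 2"
  have u0: "0 < u0" using u1 by (simp add: u0_def)
  have step: "G (2 * u) \<le> 2 ^ q * G u" if "0 < u" "u \<le> u0" for u
    using u1(2)[of u] that u1(1) G_pos[of u] by (simp add: u0_def field_simps)
  \<comment> \<open>The bound \<open>2 * u0\<close> instead of \<open>u0\<close> lets the last
    doubling start anywhere up to \<open>u0\<close> and overshoot it; rounding \<open>T\<close> up
    to a power of 2 needs this.\<close>
  have iter: "G (2 ^ k * u) \<le> (2 ^ q) ^ k * G u" if "0 < u" "2 ^ k * u \<le> 2 * u0" for k u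
    using that
  proof (induction k)
    case (Suc k)
    then have "G (2 * (2 ^ k * u)) \<le> 2 ^ q * G (2 ^ k * u)" by (intro step) auto
    also have "\<dots> \<le> 2 ^ q * ((2 ^ q) ^ k * G u)"
      using Suc u0 by (intro mult_left_mono Suc.IH) auto
    finally show ?case by (simp add: mult_ac)
  qed simp
  have near: "G (T * u) \<le> 2 ^ q * T ^ q * G u" if "0 < u" "1 \<le> T" "T * u \<le> u0" for u T
  proof -
    obtain k where k: "2 ^ k \<le> T" "T < 2 ^ (k + 1)"
      using between_powers[of 2 T] \<open>1 \<le> T\<close> by auto
    have "G (T * u) \<le> G (2 ^ (k + 1) * u)" using k that by (intro G_mono) auto
    also have "\<dots> \<le> (2 ^ q) ^ (k + 1) * G u"
    proof (rule iter[OF that(1)])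
      have "2 ^ k * u \<le> T * u" using k that by (intro mult_right_mono) auto
      then have "2 ^ k * u \<le> u0" using that(3) by (rule order_trans)
      then show "2 ^ (k + 1) * u \<le> 2 * u0" by simp
    qed
    also have "((2::real) ^ q) ^ (k + 1) = 2 ^ q * (2 ^ k) ^ q"
      by (simp add: mult.commute flip: power_mult)
    also have "2 ^ q * (2 ^ k) ^ q * G u \<le> 2 ^ q * T ^ q * G u"
      using k G_pos[OF that(1)] by (intro mult_right_mono mult_left_mono power_mono) auto
    finally show ?thesis .
  qed
  \<comment> \<open>Dividing by \<open>G u0\<close> serves the range \<open>T * u > u0\<close>: the
    estimate for reaching \<open>u0\<close> itself then says that the right-hand side is at least 1,
    hence at least \<open>G (T * u)\<close>.\<close>
  define C where "C = 2 ^ q / G u0"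
  have C: "2 ^ q \<le> C" "0 < C"
    using G_pos[OF u0] G_le_1[of u0] by (auto simp: C_def field_simps)
  have "G (T * u) \<le> C * T ^ q * G u" if "0 < u" "u \<le> u0" "1 \<le> T" for u T
  proof (cases "T * u \<le> u0")
    case True
    from near[OF that(1,3) True] show ?thesis
      using C G_pos[OF that(1)] that(3) by (smt (verit) mult_right_mono zero_le_power)
  next
    case False
    have "G (u0 / u * u) \<le> 2 ^ q * (u0 / u) ^ q * G u" using that by (intro near) auto
    also have "\<dots> \<le> 2 ^ q * T ^ q * G u"
      using that False G_pos[OF that(1)] u0
      by (intro mult_right_mono mult_left_mono power_mono) (auto simp: field_simps)
    finally have "1 \<le> C * T ^ q * G u" using that G_pos[OF u0] by (simp add: C_def field_simps)
    moreover have "G (T * u) \<le> 1" by (rule G_le_1)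
    ultimately show ?thesis by linarith
  qed
  then show ?thesis using u0 C by blast
qed

end

section \<open>Convergence of integrals\<close>

lemma integral_uniform_measure:
  fixes f :: "'a \<Rightarrow> real"
  assumes "f \<in> borel_measurable M" "A \<in> sets M" "emeasure M A \<noteq> \<infinity>" "emeasure M A \<noteq> 0"
  shows "(\<integral>x. f x \<partial>uniform_measure M A) = (\<integral>x. f x * indicator A x \<partial>M) / measure M A"
proof -
  have "uniform_measure M A = density M (\<lambda>x. ennreal (indicator A x / measure M A))"
    unfolding uniform_measure_def
  proof (rule density_cong)
    have "0 < measure M A"
      using assms by (simp add: measure_def enn2real_positive_iff top.not_eq_extremum zero_less_iff_neq_zero)
    then have "indicator A x / emeasure M A = ennreal (indicator A x / measure M A)" for x
      using assms divide_ennreal[of 1 "measure M A"]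
      by (simp add: emeasure_eq_ennreal_measure split: split_indicator)
    then show "AE x in M. indicator A x / emeasure M A = ennreal (indicator A x / measure M A)"
      by simp
  qed (use assms in measurable)
  also have "(\<integral>x. f x \<partial>\<dots>) = (\<integral>x. indicator A x / measure M A * f x \<partial>M)"
    using assms by (subst integral_real_density) auto
  also have "\<dots> = (\<integral>x. f x * indicator A x / measure M A \<partial>M)"
    by (simp add: mult.commute)
  finally show ?thesis by simp
qed

text \<open>Pointwise, the excess of \<open>h\<close> over \<open>K\<close> is at most
  \<open>h\<^sup>2 / K\<close>. The error therefore depends on \<open>h\<close> only through the
  bound on its second moment, and is uniform over a family sharing that bound.\<close>

lemma (in prob_space) integral_truncation:
  fixes h :: "'a \<Rightarrow> real"
  assumes h[measurable]: "h \<in> borel_measurable M" and pos: "AE x in M. 0 \<le> h x"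
    and B: "(\<integral>\<^sup>+x. ennreal ((h x)\<^sup>2) \<partial>M) \<le> ennreal B" "0 \<le> B" and K: "0 < K"
  shows "\<bar>(\<integral>x. h x \<partial>M) - (\<integral>x. min (h x) K \<partial>M)\<bar> \<le> B / K"
proof -
  have int2: "integrable M (\<lambda>x. (h x)\<^sup>2)"
    using B by (intro integrableI_bounded) (auto simp: order_le_less_trans[OF _ ennreal_less_top])
  have int: "integrable M h" by (rule square_integrable_imp_integrable[OF h int2])
  have intm: "integrable M (\<lambda>x. min (h x) K)"
    by (rule Bochner_Integration.integrable_bound[OF Bochner_Integration.integrable_add[OF int integrable_const[of K]]])
      (use pos K in \<open>auto elim!: eventually_mono\<close>)
  have "(\<integral>x. h x - min (h x) K \<partial>M) \<le> (\<integral>x. (h x)\<^sup>2 / K \<partial>M)"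
  proof (rule integral_mono_AE)
    show "AE x in M. h x - min (h x) K \<le> (h x)\<^sup>2 / K"
    proof (rule AE_mp[OF pos], rule AE_I2, rule impI)
      fix x assume "0 \<le> h x"
      show "h x - min (h x) K \<le> (h x)\<^sup>2 / K"
      proof (cases "h x \<le> K")
        case False
        then have "h x * K \<le> h x * h x" using K by (intro mult_left_mono) auto
        then have "h x \<le> (h x)\<^sup>2 / K" using K by (simp add: field_simps power2_eq_square)
        then show ?thesis using K False by simp
      qed (use K in simp)
    qed
  qed (use int int2 intm in auto)
  also have "\<dots> \<le> B / K"
  proof -
    have "ennreal (\<integral>x. (h x)\<^sup>2 \<partial>M) \<le> ennreal B"
      using B nn_integral_eq_integral[OF int2] by simp
    then show ?thesis using B(2) K by (simp add: divide_right_mono)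
  qed
  finally have "(\<integral>x. h x \<partial>M) - (\<integral>x. min (h x) K \<partial>M) \<le> B / K"
    using int intm by simp
  moreover have "(\<integral>x. min (h x) K \<partial>M) \<le> (\<integral>x. h x \<partial>M)"
    by (rule integral_mono[OF intm int]) simp
  ultimately show ?thesis by simp
qed

text \<open>Truncation at a level \<open>K\<close> makes dominated convergence applicable. Fatou's
  lemma passes the second-moment bound to the limit, so the same truncation error applies to
  \<open>g\<close>.\<close>

lemma (in prob_space) integral_tendsto_of_bounded_second_moments:
  fixes f :: "nat \<Rightarrow> 'a \<Rightarrow> real" and g :: "'a \<Rightarrow> real"
  assumes f[measurable]: "\<And>n. f n \<in> borel_measurable M" and g[measurable]: "g \<in> borel_measurable M"
    and pos: "\<And>n x. 0 \<le> f n x"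
    and lim: "AE x in M. (\<lambda>n. f n x) \<longlonglongrightarrow> g x"
    and B: "\<And>n. (\<integral>\<^sup>+x. ennreal ((f n x)\<^sup>2) \<partial>M) \<le> ennreal B" "0 \<le> B"
  shows "(\<lambda>n. \<integral>x. f n x \<partial>M) \<longlonglongrightarrow> (\<integral>x. g x \<partial>M)"
proof (rule LIMSEQ_I)
  have gpos: "AE x in M. 0 \<le> g x"
    using lim by eventually_elim (use pos in \<open>auto intro: LIMSEQ_le_const\<close>)
  have "(\<integral>\<^sup>+x. ennreal ((g x)\<^sup>2) \<partial>M) = (\<integral>\<^sup>+x. liminf (\<lambda>n. ennreal ((f n x)\<^sup>2)) \<partial>M)"
  proof (rule nn_integral_cong_AE, use lim in eventually_elim)
    case (elim x)
    then have "(\<lambda>n. ennreal ((f n x)\<^sup>2)) \<longlonglongrightarrow> ennreal ((g x)\<^sup>2)"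
      by (intro tendsto_intros) auto
    from lim_imp_Liminf[OF sequentially_bot this] show ?case by simp
  qed
  also have "\<dots> \<le> liminf (\<lambda>n. \<integral>\<^sup>+x. ennreal ((f n x)\<^sup>2) \<partial>M)"
    by (rule nn_integral_liminf) auto
  also have "\<dots> \<le> ennreal B"
    using B(1) Liminf_mono[of "\<lambda>n. \<integral>\<^sup>+x. ennreal ((f n x)\<^sup>2) \<partial>M" "\<lambda>_. ennreal B" sequentially]
    by (simp add: Liminf_const)
  finally have gB: "(\<integral>\<^sup>+x. ennreal ((g x)\<^sup>2) \<partial>M) \<le> ennreal B" .
  fix e :: real assume e: "0 < e"
  \<comment> \<open>This makes \<open>B / K < e / 3\<close>; the summand 1 keeps \<open>K\<close>
    positive when \<open>B\<close> is 0.\<close>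
  define K where "K = 3 * B / e + 1"
  have K: "0 < K" using e B(2) by (simp add: K_def add_nonneg_pos)
  have "B / K < e / 3" using e B(2) K by (simp add: K_def field_simps)
  have "(\<lambda>n. \<integral>x. min (f n x) K \<partial>M) \<longlonglongrightarrow> (\<integral>x. min (g x) K \<partial>M)"
  proof (rule integral_dominated_convergence[where w = "\<lambda>_. K"])
    show "AE x in M. (\<lambda>n. min (f n x) K) \<longlonglongrightarrow> min (g x) K"
      using lim by eventually_elim (intro tendsto_intros)
    show "AE x in M. norm (min (f n x) K) \<le> K" for n
    proof (rule AE_I2)
      fix x
      show "norm (min (f n x) K) \<le> K" using pos[of n x] K by simp
    qed
  qed auto
  from LIMSEQ_D[OF this, of "e / 3"] e obtain n0 where n0:
    "\<And>n. n0 \<le> n \<Longrightarrow> \<bar>(\<integral>x. min (f n x) K \<partial>M) - (\<integral>x. min (g x) K \<partial>M)\<bar> < e / 3"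
    by auto
  show "\<exists>n0. \<forall>n\<ge>n0. norm ((\<integral>x. f n x \<partial>M) - (\<integral>x. g x \<partial>M)) < e"
  proof (intro exI[of _ n0] allI impI)
    fix n assume "n0 \<le> n"
    note n0[OF this]
    moreover have "\<bar>(\<integral>x. f n x \<partial>M) - (\<integral>x. min (f n x) K \<partial>M)\<bar> \<le> B / K"
      using pos by (intro integral_truncation B K) auto
    moreover have "\<bar>(\<integral>x. g x \<partial>M) - (\<integral>x. min (g x) K \<partial>M)\<bar> \<le> B / K"
      by (intro integral_truncation gB gpos B K) auto
    ultimately show "norm ((\<integral>x. f n x \<partial>M) - (\<integral>x. g x \<partial>M)) < e"
      using \<open>B / K < e / 3\<close> unfolding real_norm_def by linarith
  qed
qed

text \<open>A dyadic decomposition of the range of \<open>Z\<close>. The tail has one power more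
  than the moment, so the layer with index \<open>i\<close> contributes a multiple of
  \<open>(1 / 2) ^ i\<close> and the layers form a geometric series.\<close>

lemma (in prob_space) moment_le_of_tail:
  fixes Z :: "'a \<Rightarrow> real"
  assumes Z[measurable]: "Z \<in> borel_measurable M" and Z1: "\<And>x. 1 \<le> Z x"
    and tail: "\<And>s. 1 \<le> s \<Longrightarrow> prob {x\<in>space M. s < Z x} * s ^ (k + 1) \<le> 2"
  shows "(\<integral>\<^sup>+x. ennreal (Z x ^ k) \<partial>M) \<le> ennreal (2 ^ k + 2 ^ (2 * k + 2))"
proof -
  define A where "A = (\<lambda>i::nat. {x\<in>space M. 2 ^ i < Z x})"
  have A[measurable]: "A i \<in> sets M" for i by (simp add: A_def)
  have ptw: "ennreal (Z x ^ k) \<le> ennreal (2 ^ k) + (\<Sum>i. ennreal (2 ^ ((i + 2) * k)) * indicator (A i) x)"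
    if x: "x \<in> space M" for x
  proof (cases "Z x \<le> 2")
    case True
    have "Z x ^ k \<le> 2 ^ k" by (rule power_mono) (use True Z1[of x] in auto)
    then show ?thesis by (intro add_increasing2) (auto intro: ennreal_leI)
  next
    case False
    obtain j where j: "2 ^ j \<le> Z x" "Z x < 2 ^ (j + 1)"
      using between_powers[of 2 "Z x"] Z1[of x] by auto
    have "j \<noteq> 0" using j False by (intro notI) simp
    \<comment> \<open>The layer is moved one index down because \<open>A i\<close> asks for a strict
      inequality, while the bracket gives only \<open>2 ^ j \<le> Z x\<close>; this is the reason
      for \<open>i + 2\<close> in the exponent.\<close>
    then obtain i where i: "j = i + 1" by (cases j) auto
    have "(2::real) ^ i < 2 ^ j" using i by simp
    then have "2 ^ i < Z x" using j(1) by (rule less_le_trans)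
    then have xA: "x \<in> A i" using x by (simp add: A_def)
    have "Z x ^ k \<le> (2 ^ (j + 1)) ^ k" by (rule power_mono) (use j Z1[of x] in auto)
    also have "\<dots> = 2 ^ ((i + 2) * k)" by (simp only: i power_mult) simp
    finally have "ennreal (Z x ^ k) \<le> ennreal (2 ^ ((i + 2) * k)) * indicator (A i) x"
      using xA by (simp add: ennreal_leI)
    also have "\<dots> \<le> (\<Sum>i. ennreal (2 ^ ((i + 2) * k)) * indicator (A i) x)"
      using sum_le_suminf[OF summableI, of "{i}"] by simp
    finally show ?thesis by (intro add_increasing) auto
  qed
  have "(\<integral>\<^sup>+x. ennreal (Z x ^ k) \<partial>M) \<le>
      (\<integral>\<^sup>+x. ennreal (2 ^ k) + (\<Sum>i. ennreal (2 ^ ((i + 2) * k)) * indicator (A i) x) \<partial>M)"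
    by (rule nn_integral_mono) (rule ptw)
  also have "\<dots> = ennreal (2 ^ k) + (\<Sum>i. ennreal (2 ^ ((i + 2) * k)) * emeasure M (A i))"
    by (simp add: nn_integral_add nn_integral_suminf nn_integral_cmult_indicator emeasure_space_1)
  also have "(\<Sum>i. ennreal (2 ^ ((i + 2) * k)) * emeasure M (A i)) \<le> (\<Sum>i. ennreal (2 ^ (2 * k + 1) * (1 / 2) ^ i))"
  proof (intro suminf_le summableI allI)
    fix i
    have "prob (A i) * (2 ^ i) ^ (k + 1) \<le> 2" unfolding A_def by (rule tail) simp
    then have "2 ^ (2 * k) * (prob (A i) * (2 ^ i) ^ k * 2 ^ i) \<le> 2 ^ (2 * k) * 2"
      by (intro mult_left_mono) (auto simp: mult_ac)
    then have "2 ^ (2 * k) * (prob (A i) * (2 ^ i) ^ k) \<le> 2 ^ (2 * k) * 2 / 2 ^ i"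
      by (subst pos_le_divide_eq) (auto simp: mult.assoc)
    moreover have "(2::real) ^ ((i + 2) * k) = 2 ^ (2 * k) * (2 ^ i) ^ k"
      by (simp only: power_add[symmetric] power_mult[symmetric] algebra_simps)
    moreover have "2 ^ (2 * k) * 2 / 2 ^ i = (2::real) ^ (2 * k + 1) * (1 / 2) ^ i"
      by (simp add: power_one_over)
    ultimately have "2 ^ ((i + 2) * k) * prob (A i) \<le> 2 ^ (2 * k + 1) * (1 / 2) ^ i"
      by (simp only: mult_ac)
    then show "ennreal (2 ^ ((i + 2) * k)) * emeasure M (A i) \<le> ennreal (2 ^ (2 * k + 1) * (1 / 2) ^ i)"
      by (simp add: emeasure_eq_measure ennreal_leI flip: ennreal_mult)
  qed
  also have "\<dots> = ennreal (2 ^ (2 * k + 1) * 2)"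
  proof (rule suminf_ennreal_eq)
    show "(\<lambda>i. 2 ^ (2 * k + 1) * (1 / 2) ^ i) sums (2 ^ (2 * k + 1) * 2 :: real)"
      using sums_mult[OF geometric_sums[of "1 / 2 :: real"], of "2 ^ (2 * k + 1)"] by simp
  qed simp
  finally show ?thesis by (simp flip: ennreal_plus)
qed

text \<open>For \<open>t \<ge> 0\<close> the event that the rescaled excess is above
  \<open>t\<close> already implies that the threshold is exceeded, so its conditional probability is
  exactly the ratio in the Gumbel condition. The distribution functions thus converge at every
  point.\<close>

lemma conditional_law_converges_to_exponential:
  fixes \<mu> :: "real measure" and y :: "nat \<Rightarrow> real"
  assumes "real_distribution \<mu>" and "gumbel_tail (\<lambda>x. measure \<mu> {x<..}) w"
    and y: "filterlim y at_top sequentially"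
    and y_pos: "\<And>n. 0 < y n"
  defines "\<mu>s \<equiv> \<lambda>n. distr (uniform_measure \<mu> {y n<..}) borel (\<lambda>r. (r - y n) * w (y n))"
  shows "real_distribution (\<mu>s n)"
    and "0 \<le> t \<Longrightarrow> measure (\<mu>s n) {t<..} = measure \<mu> {y n + t / w (y n)<..} / measure \<mu> {y n<..}"
    and "weak_conv_m \<mu>s (density lborel (exponential_density 1))"
proof -
  interpret \<mu>: real_distribution \<mu> by fact
  interpret gumbel_tail "\<lambda>x. measure \<mu> {x<..}" w by fact
  have nz: "emeasure \<mu> {y n<..} \<noteq> 0" for n
    using S_pos[of "y n"] by (simp add: \<mu>.emeasure_eq_measure)
  have pU: "prob_space (uniform_measure \<mu> {y n<..})" for n
    using nz by (intro prob_space_uniform_measure) (auto simp: \<mu>.emeasure_eq_measure)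
  have meas[measurable]: "(\<lambda>r. (r - y n) * w (y n)) \<in> borel_measurable borel" for n by measurable
  have wy: "0 < w (y n)" for n using w_pos y_pos by simp
  show rd: "real_distribution (\<mu>s n)" for n
    unfolding \<mu>s_def by (rule prob_space.real_distribution_distr[OF pU]) simp
  have meas_eq: "measure (\<mu>s n) A = measure \<mu> ({y n<..} \<inter> (\<lambda>r. (r - y n) * w (y n)) -` A) / measure \<mu> {y n<..}"
    if [measurable]: "A \<in> sets borel" for n A
    unfolding \<mu>s_def using nz
    by (subst measure_distr) (auto simp: \<mu>.emeasure_eq_measure measure_uniform_measure measurable_sets_borel[OF meas that])
  show tail: "measure (\<mu>s n) {t<..} = measure \<mu> {y n + t / w (y n)<..} / measure \<mu> {y n<..}"
    if "0 \<le> t" for n t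
  proof -
    have "{y n<..} \<inter> (\<lambda>r. (r - y n) * w (y n)) -` {t<..} = {y n + t / w (y n)<..}"
      using wy[of n] that by (auto simp: field_simps) (smt (verit) mult_nonneg_nonneg mult_less_cancel_left_pos mult.commute)
    then show ?thesis by (simp add: meas_eq)
  qed
  have cdf_M: "cdf (density lborel (exponential_density 1)) t = (if t < 0 then 0 else 1 - exp (- t))" for t
  proof -
    have "emeasure (density lborel (exponential_density 1)) {..t} = ennreal (erlang_CDF 0 1 t)"
      by (rule emeasure_erlang_density) simp
    then show ?thesis by (simp add: cdf_def measure_def erlang_CDF_def)
  qed
  have "(\<lambda>n. cdf (\<mu>s n) t) \<longlonglongrightarrow> cdf (density lborel (exponential_density 1)) t" for t
  proof (cases "t < 0")
    case True
    have "{y n<..} \<inter> (\<lambda>r. (r - y n) * w (y n)) -` {..t} = {}" for n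
      using wy[of n] True by (auto simp: mult_less_0_iff dest!: order_le_less_trans)
    then have "cdf (\<mu>s n) t = 0" for n by (simp add: cdf_def meas_eq)
    then show ?thesis using True by (simp add: cdf_M)
  next
    case False
    have "cdf (\<mu>s n) t = 1 - measure \<mu> {y n + t / w (y n)<..} / measure \<mu> {y n<..}" for n
    proof -
      interpret \<nu>: real_distribution "\<mu>s n" by (rule rd)
      have "cdf (\<mu>s n) t = 1 - measure (\<mu>s n) {t<..}"
        using \<nu>.prob_compl[of "{..t}"] by (simp add: cdf_def Compl_eq_Diff_UNIV[symmetric])
      then show ?thesis using tail[of t n] False by simp
    qed
    moreover have "(\<lambda>n. 1 - measure \<mu> {y n + t / w (y n)<..} / measure \<mu> {y n<..}) \<longlonglongrightarrow> 1 - exp (- t)"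
      by (intro tendsto_intros filterlim_compose[OF S_limit y])
    ultimately show ?thesis using False by (simp add: cdf_M)
  qed
  then show "weak_conv_m \<mu>s (density lborel (exponential_density 1))"
    by (simp add: weak_conv_m_def weak_conv_def)
qed

text \<open>Euler's integral: the Gamma factor of the final formula is the moment of order
  \<open>\<gamma>\<close> of the limiting exponential variable.\<close>

lemma integral_powr_exponential_density:
  fixes \<gamma> :: real
  assumes "0 \<le> \<gamma>"
  shows "(\<integral>t. t powr \<gamma> \<partial>density lborel (exponential_density 1)) = Gamma (\<gamma> + 1)"
proof -
  have "(\<integral>t. t powr \<gamma> \<partial>density lborel (exponential_density 1)) =
      (\<integral>t. indicator {0..} t * t powr (\<gamma> + 1 - 1) / exp t \<partial>lborel)"
    by (subst integral_real_density)
      (auto intro!: Bochner_Integration.integral_cong simp: exponential_density_def exp_minus field_simps)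
  also have "\<dots> = Gamma (\<gamma> + 1)"
    by (rule integral_eq_nn_integral[THEN trans])
      (use assms Gamma_real_pos[of "\<gamma> + 1"] Gamma_conv_nn_integral_real[of "\<gamma> + 1", symmetric] in auto)
  finally show ?thesis .
qed

text \<open>With \<open>r = y + t / w y\<close> and v = y w(y), the argument
  \<open>1 - y / r\<close> equals 1 - 1/(1 + t/v), which is close to t/v. Hence the integrand
  divided by G(1/v) tends to \<open>t powr \<gamma>\<close>. The limit is tested along sequences,
  because the representation of weak limits by pointwise limits concerns sequences.\<close>

theorem integral_mono_regvar_gumbel_tail:
  fixes \<mu> :: "real measure" and G :: "real \<Rightarrow> real"
  assumes "real_distribution \<mu>" and "gumbel_tail (\<lambda>x. measure \<mu> {x<..}) w"
    and "mono_regvar G \<gamma>" and nonneg: "\<And>t. 0 \<le> G t" and \<gamma>: "0 \<le> \<gamma>"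
  shows "((\<lambda>y. (\<integral>r. G (1 - y / r) * indicator {y<..} r \<partial>\<mu>) /
      (measure \<mu> {y<..} * G (1 / (y * w y)))) \<longlongrightarrow> Gamma (\<gamma> + 1)) at_top"
proof (rule tendsto_at_topI_sequentially)
  interpret \<mu>: real_distribution \<mu> by fact
  interpret gumbel_tail "\<lambda>x. measure \<mu> {x<..}" w by fact
  interpret mono_regvar G \<gamma> by fact
  have G_meas[measurable]: "G \<in> borel_measurable borel"
    by (rule borel_measurable_mono) (auto simp: mono_def G_mono)
  define J where "J = (\<lambda>y. (\<integral>r. G (1 - y / r) * indicator {y<..} r \<partial>\<mu>) / (measure \<mu> {y<..} * G (1 / (y * w y))))"
  obtain u0 C q where u0: "0 < u0" "0 < C"
    and potter: "\<And>u T. 0 < u \<Longrightarrow> u \<le> u0 \<Longrightarrow> 1 \<le> T \<Longrightarrow> G (T * u) \<le> C * T ^ q * G u"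
    using potter by blast
  \<comment> \<open>The square of the integrand grows like a power \<open>2 * q\<close>; the
    exponent is one larger, as the moment estimate demands of the tail.\<close>
  obtain \<eta> where \<eta>: "0 < \<eta>" "\<forall>\<^sub>F x in at_top. \<forall>t\<ge>0.
      measure \<mu> {x + t / w x<..} * (1 + \<eta> * t) ^ (2 * q + 1) \<le> 2 * measure \<mu> {x<..}"
    using polynomial_tail_bound by blast
  fix X :: "nat \<Rightarrow> real" assume X: "filterlim X at_top sequentially"
  have "\<forall>\<^sub>F x in at_top. 0 < x \<and> 1 / u0 \<le> x * w x \<and> (\<forall>t\<ge>0.
      measure \<mu> {x + t / w x<..} * (1 + \<eta> * t) ^ (2 * q + 1) \<le> 2 * measure \<mu> {x<..})"
    using \<eta>(2) eventually_gt_at_top[of 0] filterlim_at_top[THEN iffD1, OF v_at_top, rule_format, of "1 / u0"]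
    by eventually_elim blast
  from eventually_compose_filterlim[OF this X] obtain n0 where n0: "\<And>n. n0 \<le> n \<Longrightarrow>
      0 < X n \<and> 1 / u0 \<le> X n * w (X n) \<and> (\<forall>t\<ge>0.
      measure \<mu> {X n + t / w (X n)<..} * (1 + \<eta> * t) ^ (2 * q + 1) \<le> 2 * measure \<mu> {X n<..})"
    by (auto simp: eventually_sequentially)
  \<comment> \<open>Dropping the first \<open>n0\<close> terms makes the tail bound and
    \<open>1 / v n \<le> u0\<close> hold for every index; \<open>LIMSEQ_offset\<close> restores the
    original sequence.\<close>
  define y where "y = (\<lambda>n. X (n + n0))"
  define v where "v = (\<lambda>n. y n * w (y n))"
  have y: "filterlim y at_top sequentially"
    unfolding y_def by (rule filterlim_compose[OF X filterlim_add_const_nat_at_top])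
  have y_pos: "0 < y n" for n using n0[of "n + n0"] by (simp add: y_def)
  have wy: "0 < w (y n)" for n using w_pos y_pos by simp
  have v_pos: "0 < v n" for n using y_pos wy by (simp add: v_def)
  have v_u0: "1 / v n \<le> u0" for n
    using n0[of "n + n0"] u0 v_pos[of n] by (simp add: y_def v_def field_simps)
  have v_inf: "filterlim v at_top sequentially"
    unfolding v_def by (rule filterlim_compose[OF v_at_top y])
  have v_0: "filterlim (\<lambda>n. 1 / v n) (at_right 0) sequentially"
    using filterlim_compose[OF filterlim_inverse_at_right_top v_inf] by (simp add: inverse_eq_divide)
  define \<mu>s where "\<mu>s = (\<lambda>n. distr (uniform_measure \<mu> {y n<..}) borel (\<lambda>r. (r - y n) * w (y n)))"
  have \<mu>s_n: "\<mu>s n = distr (uniform_measure \<mu> {y n<..}) borel (\<lambda>r. (r - y n) * w (y n))" for n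
    by (simp add: \<mu>s_def)
  note cond = conditional_law_converges_to_exponential[OF assms(1,2) y y_pos, folded \<mu>s_n]
  define E where "E = density lborel (exponential_density 1)"
  have E: "real_distribution E"
    unfolding E_def real_distribution_def real_distribution_axioms_def
    by (auto intro: prob_space_exponential_density)
  \<comment> \<open>On this common space the rescaled excesses converge pointwise, so the moving
    argument of \<open>G\<close> can be treated sample by sample.\<close>
  obtain \<Omega> :: "real measure" and T T' where Skorohod: "prob_space \<Omega>"
    "\<forall>n. T n \<in> borel_measurable \<Omega>" "\<forall>n. distr \<Omega> borel (T n) = \<mu>s n"
    "T' \<in> measurable \<Omega> lborel" "distr \<Omega> borel T' = E"
    "\<forall>x\<in>space \<Omega>. (\<lambda>n. T n x) \<longlonglongrightarrow> T' x"
    using Skorohod[OF cond(1) E cond(3)[folded E_def]] by blast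
  interpret \<Omega>: prob_space \<Omega> by fact
  have T[measurable]: "T n \<in> borel_measurable \<Omega>" and T_distr: "distr \<Omega> borel (T n) = \<mu>s n" for n
    using Skorohod by auto
  have T'[measurable]: "T' \<in> borel_measurable \<Omega>" and T'_distr: "distr \<Omega> borel T' = E"
    and T_lim: "\<And>x. x \<in> space \<Omega> \<Longrightarrow> (\<lambda>n. T n x) \<longlonglongrightarrow> T' x"
    using Skorohod by auto
  \<comment> \<open>The integrand in the excess variable. The conditional laws live on positive
    \<open>t\<close>, so \<open>max 0 t\<close> does not change the integral; it keeps the
    denominator at least 1 for every real \<open>t\<close>.\<close>
  define \<phi> where "\<phi> = (\<lambda>n t. G (1 - 1 / (1 + max 0 t / v n)) / G (1 / v n))"
  have \<phi>_meas[measurable]: "\<phi> n \<in> borel_measurable borel" for n by (simp add: \<phi>_def)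
  have \<phi>_pos: "0 \<le> \<phi> n t" for n t
    using nonneg by (simp add: \<phi>_def)
  have J_eq: "J (y n) = (\<integral>x. \<phi> n (T n x) \<partial>\<Omega>)" for n
  proof -
    have "(\<integral>x. \<phi> n (T n x) \<partial>\<Omega>) = (\<integral>t. \<phi> n t \<partial>\<mu>s n)"
      by (simp add: integral_distr flip: T_distr)
    also have "\<dots> = (\<integral>r. \<phi> n ((r - y n) * w (y n)) \<partial>uniform_measure \<mu> {y n<..})"
      unfolding \<mu>s_def by (rule integral_distr) auto
    also have "\<dots> = (\<integral>r. \<phi> n ((r - y n) * w (y n)) * indicator {y n<..} r \<partial>\<mu>) / measure \<mu> {y n<..}"
      by (rule integral_uniform_measure)
        (use S_pos[of "y n"] in \<open>auto simp: \<mu>.emeasure_eq_measure\<close>)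
    also have "(\<lambda>r. \<phi> n ((r - y n) * w (y n)) * indicator {y n<..} r) =
        (\<lambda>r. (G (1 - y n / r) * indicator {y n<..} r) / G (1 / v n))"
    proof
      fix r
      show "\<phi> n ((r - y n) * w (y n)) * indicator {y n<..} r =
        (G (1 - y n / r) * indicator {y n<..} r) / G (1 / v n)"
      proof (cases "y n < r")
        case True
        have "1 - 1 / (1 + max 0 ((r - y n) * w (y n)) / v n) = 1 - y n / r"
          using True y_pos[of n] wy[of n] by (simp add: v_def field_simps max_def)
        then show ?thesis using True by (simp add: \<phi>_def)
      qed simp
    qed
    finally show ?thesis by (simp add: J_def v_def mult.commute)
  qed
  have \<phi>_lim: "(\<lambda>n. \<phi> n (T n x)) \<longlonglongrightarrow> T' x powr \<gamma>" if "x \<in> space \<Omega>" "0 < T' x" for x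
  proof -
    have inv: "(\<lambda>n. 1 / v n) \<longlonglongrightarrow> 0" using v_0 by (simp add: filterlim_at)
    have mx: "(\<lambda>n. max 0 (T n x)) \<longlonglongrightarrow> max 0 (T' x)"
      by (intro tendsto_intros T_lim that)
    have "(\<lambda>n. max 0 (T n x) / (1 + max 0 (T n x) * (1 / v n))) \<longlonglongrightarrow> max 0 (T' x) / (1 + max 0 (T' x) * 0)"
      by (intro tendsto_intros inv mx) simp
    then have "(\<lambda>n. max 0 (T n x) / (1 + max 0 (T n x) * (1 / v n))) \<longlonglongrightarrow> T' x"
      using that by simp
    from locally_uniform[OF v_0 this that(2)]
    have "(\<lambda>n. G (max 0 (T n x) / (1 + max 0 (T n x) * (1 / v n)) * (1 / v n)) / G (1 / v n)) \<longlonglongrightarrow> T' x powr \<gamma>" .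
    moreover have "max 0 (T n x) / (1 + max 0 (T n x) * (1 / v n)) * (1 / v n) = 1 - 1 / (1 + max 0 (T n x) / v n)" for n
    proof -
      have "0 < v n + max 0 (T n x)" using v_pos[of n] by simp
      then show ?thesis using v_pos[of n] by (simp add: field_simps del: max.absorb1 max.absorb2)
    qed
    ultimately show ?thesis by (simp add: \<phi>_def)
  qed
  \<comment> \<open>The pointwise limit was obtained only where \<open>T'\<close> is positive; the
    exponential law gives no mass to the rest.\<close>
  have "measure \<Omega> {x \<in> space \<Omega>. T' x \<le> 0} = 0"
  proof -
    have "measure \<Omega> {x \<in> space \<Omega>. T' x \<le> 0} = measure E {..0}"
      unfolding T'_distr[symmetric] by (subst measure_distr) (auto intro!: arg_cong[where f = "measure \<Omega>"])
    also have "\<dots> = 0"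
      using emeasure_erlang_density[of 1 0 0] by (simp add: E_def measure_def erlang_CDF_def)
    finally show ?thesis .
  qed
  then have T'_pos: "AE x in \<Omega>. 0 < T' x"
    by (subst (asm) \<Omega>.prob_eq_0) (auto simp: not_le elim!: eventually_mono)
  \<comment> \<open>Chosen so that \<open>1 + s \<le> D * (1 + \<eta> * s)\<close> for
    \<open>s \<ge> 0\<close>, which trades the variable of the Potter bound for that of the tail
    bound.\<close>
  define D where "D = 1 / min 1 \<eta>"
  have D: "1 \<le> D" "1 \<le> \<eta> * D" using \<eta> by (auto simp: D_def min_def field_simps)
  define Z where "Z = (\<lambda>n x. 1 + \<eta> * max 0 (T n x))"
  have Z1: "1 \<le> Z n x" for n x using \<eta> by (simp add: Z_def)
  have \<phi>_le: "(\<phi> n (T n x))\<^sup>2 \<le> C\<^sup>2 * D ^ (2 * q) * Z n x ^ (2 * q)" for n x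
  proof -
    define s where "s = max 0 (T n x)"
    have s: "0 \<le> s" by (simp add: s_def)
    \<comment> \<open>The factor \<open>1 + s\<close> instead of \<open>s\<close> keeps the scaling
      factor at least 1, where the Potter bound is valid.\<close>
    have "1 - 1 / (1 + s / v n) \<le> (1 + s) * (1 / v n)"
    proof -
      have "1 - 1 / (1 + s / v n) = s / (v n + s)"
        using s v_pos[of n] by (simp add: field_simps)
      also have "\<dots> \<le> (1 + s) / v n"
        using s v_pos[of n] by (intro frac_le) auto
      finally show ?thesis by simp
    qed
    then have "G (1 - 1 / (1 + s / v n)) \<le> G ((1 + s) * (1 / v n))" by (rule G_mono)
    also have "\<dots> \<le> C * (1 + s) ^ q * G (1 / v n)"
      using s v_pos v_u0 by (intro potter) auto
    finally have "\<phi> n (T n x) \<le> C * (1 + s) ^ q"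
      using G_pos[of "1 / v n"] v_pos by (simp add: \<phi>_def s_def field_simps)
    also have "\<dots> \<le> C * (D * Z n x) ^ q"
    proof (intro mult_left_mono power_mono)
      have "1 * s \<le> \<eta> * D * s" using D s by (intro mult_right_mono) auto
      moreover have "D * Z n x = D + \<eta> * D * s" by (simp only: Z_def s_def algebra_simps)
      ultimately show "1 + s \<le> D * Z n x" using D by linarith
    qed (use u0 s in auto)
    finally have "(\<phi> n (T n x))\<^sup>2 \<le> (C * (D * Z n x) ^ q)\<^sup>2"
      using \<phi>_pos by (intro power_mono)
    then show ?thesis by (simp add: power_mult_distrib mult_ac flip: power_mult)
  qed
  define B where "B = C\<^sup>2 * D ^ (2 * q) * (2 ^ (2 * q) + 2 ^ (2 * (2 * q) + 2))"
  have B: "0 \<le> B" using D u0 by (auto simp: B_def intro!: mult_nonneg_nonneg)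
  have second_moment: "(\<integral>\<^sup>+x. ennreal ((\<phi> n (T n x))\<^sup>2) \<partial>\<Omega>) \<le> ennreal B" for n
  proof -
    have Z_meas[measurable]: "Z n \<in> borel_measurable \<Omega>" by (simp add: Z_def)
    have "\<Omega>.prob {x \<in> space \<Omega>. s < Z n x} * s ^ (2 * q + 1) \<le> 2" if s: "1 \<le> s" for s
    proof -
      define t where "t = (s - 1) / \<eta>"
      have t: "0 \<le> t" "s = 1 + \<eta> * t" using s \<eta> by (auto simp: t_def)
      have "{x \<in> space \<Omega>. s < Z n x} = T n -` {t<..} \<inter> space \<Omega>"
        using \<eta> t by (auto simp: Z_def max_def)
      then have "\<Omega>.prob {x \<in> space \<Omega>. s < Z n x} = measure (\<mu>s n) {t<..}"
        by (simp add: measure_distr flip: T_distr)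
      also have "\<dots> = measure \<mu> {y n + t / w (y n)<..} / measure \<mu> {y n<..}"
        by (rule cond(2)[OF t(1)])
      finally have "\<Omega>.prob {x \<in> space \<Omega>. s < Z n x} * s ^ (2 * q + 1) =
          measure \<mu> {y n + t / w (y n)<..} * (1 + \<eta> * t) ^ (2 * q + 1) / measure \<mu> {y n<..}"
        by (simp only: t(2) times_divide_eq_left)
      also have "\<dots> \<le> 2"
        using n0[of "n + n0"] t(1) S_pos[of "y n"] by (subst pos_divide_le_eq) (auto simp only: y_def)
      finally show ?thesis .
    qed
    from \<Omega>.moment_le_of_tail[OF Z_meas Z1 this]
    have Zk: "(\<integral>\<^sup>+x. ennreal (Z n x ^ (2 * q)) \<partial>\<Omega>) \<le> ennreal (2 ^ (2 * q) + 2 ^ (2 * (2 * q) + 2))" by simp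
    have "(\<integral>\<^sup>+x. ennreal ((\<phi> n (T n x))\<^sup>2) \<partial>\<Omega>) \<le>
        (\<integral>\<^sup>+x. ennreal (C\<^sup>2 * D ^ (2 * q)) * ennreal (Z n x ^ (2 * q)) \<partial>\<Omega>)"
      using D Z1 by (intro nn_integral_mono) (auto simp: \<phi>_le ennreal_leI simp flip: ennreal_mult')
    also have "\<dots> = ennreal (C\<^sup>2 * D ^ (2 * q)) * (\<integral>\<^sup>+x. ennreal (Z n x ^ (2 * q)) \<partial>\<Omega>)"
      by (rule nn_integral_cmult) measurable
    also have "\<dots> \<le> ennreal (C\<^sup>2 * D ^ (2 * q)) * ennreal (2 ^ (2 * q) + 2 ^ (2 * (2 * q) + 2))"
      by (rule mult_left_mono[OF Zk]) simp
    also have "\<dots> = ennreal B"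
      unfolding B_def using D by (intro ennreal_mult[symmetric]) auto
    finally show ?thesis .
  qed
  have "(\<lambda>n. \<integral>x. \<phi> n (T n x) \<partial>\<Omega>) \<longlonglongrightarrow> (\<integral>x. T' x powr \<gamma> \<partial>\<Omega>)"
    by (rule \<Omega>.integral_tendsto_of_bounded_second_moments[OF _ _ \<phi>_pos _ second_moment B])
      (use AE_mp[OF T'_pos] \<phi>_lim in auto)
  also have "(\<integral>x. T' x powr \<gamma> \<partial>\<Omega>) = (\<integral>t. t powr \<gamma> \<partial>E)"
    by (simp add: integral_distr flip: T'_distr)
  also have "\<dots> = Gamma (\<gamma> + 1)"
    unfolding E_def by (rule integral_powr_exponential_density[OF \<gamma>])
  finally have "(\<lambda>n. J (y n)) \<longlonglongrightarrow> Gamma (\<gamma> + 1)" by (simp add: J_eq)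
  then have "(\<lambda>n. J (X n)) \<longlonglongrightarrow> Gamma (\<gamma> + 1)"
    unfolding y_def by (rule LIMSEQ_offset)
  then show "(\<lambda>n. (\<integral>r. G (1 - X n / r) * indicator {X n<..} r \<partial>\<mu>) /
      (measure \<mu> {X n<..} * G (1 / (X n * w (X n))))) \<longlonglongrightarrow> Gamma (\<gamma> + 1)"
    by (simp add: J_def)
qed

section \<open>The critical region\<close>

text \<open>The choice \<open>d = 1\<close>, \<open>1 / x = a / ar * \<tau>\<close> turns the level
  \<open>a / ar - d / x\<close> into \<open>a / ar * (1 - \<tau>)\<close>, the one that the second
  constraint imposes on z(W). The displacement \<open>c * d / x\<close> becomes
  \<open>c * a / ar * \<tau>\<close>, which is where $K_2$ comes from.\<close>

lemma admissible_branch: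
  assumes adm: "admissible a \<rho> zs ar \<epsilon> c" and a: "0 < a"
  obtains y where "\<forall>\<^sub>F \<tau> in at_right 0. y \<tau> \<in> V ar \<epsilon> \<and> zfun \<rho> zs (y \<tau>) = a / ar * (1 - \<tau>)"
    and "((\<lambda>\<tau>. (y \<tau> - 1 / ar) / \<tau>) \<longlongrightarrow> c * a / ar) (at_right 0)"
proof
  have ar: "0 < ar" and c: "0 < c" and decr: "strict_antimono_on (V ar \<epsilon>) (zfun \<rho> zs)"
    using adm by (auto simp: admissible_def)
  have "compact {1::real} \<and> {1::real} \<subseteq> {0<..}" by simp
  then have level: "\<forall>\<^sub>F x in at_top. \<forall>d\<in>{1}. a / ar - d / x \<in> zfun \<rho> zs ` V ar \<epsilon>"
    and unif: "uniform_limit {1}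
          (\<lambda>x d. (the_inv_into (V ar \<epsilon>) (zfun \<rho> zs) (a / ar - d / x) - 1 / ar) / (c * d / x))
          (\<lambda>_. 1) at_top"
    using adm unfolding admissible_def by blast+
  have inj: "inj_on (zfun \<rho> zs) (V ar \<epsilon>)"
    using decr strict_antimono_iff_antimono by blast
  define y where "y = (\<lambda>\<tau>. the_inv_into (V ar \<epsilon>) (zfun \<rho> zs) (a / ar * (1 - \<tau>)))"
  define x where "x = (\<lambda>\<tau>::real. inverse (a / ar * \<tau>))"
  have x: "filterlim x at_top (at_right 0)"
    unfolding x_def
  proof (rule filterlim_compose[OF filterlim_inverse_at_top_right])
    show "filterlim (\<lambda>\<tau>. a / ar * \<tau>) (at_right 0) (at_right 0)"
      unfolding filterlim_at
    proof
      show "((\<lambda>\<tau>. a / ar * \<tau>) \<longlongrightarrow> 0) (at_right 0)" using ar by (auto intro!: tendsto_eq_intros)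
      show "\<forall>\<^sub>F \<tau> in at_right 0. a / ar * \<tau> \<in> {0<..} \<and> a / ar * \<tau> \<noteq> 0"
        using eventually_at_right_less[of 0] by eventually_elim (use a ar in auto)
    qed
  qed
  have lvl: "a / ar - 1 / x \<tau> = a / ar * (1 - \<tau>)" for \<tau>
    using ar by (simp add: x_def field_simps)
  from eventually_compose_filterlim[OF level x]
  show "\<forall>\<^sub>F \<tau> in at_right 0. y \<tau> \<in> V ar \<epsilon> \<and> zfun \<rho> zs (y \<tau>) = a / ar * (1 - \<tau>)"
    by eventually_elim (use inj in \<open>auto simp: lvl y_def f_the_inv_into_f intro: the_inv_into_into\<close>)
  have "((\<lambda>\<tau>. (y \<tau> - 1 / ar) / (c * 1 / x \<tau>)) \<longlongrightarrow> 1) (at_right 0)"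
    using filterlim_compose[OF tendsto_uniform_limitI[OF unif, of 1] x] by (simp add: lvl y_def)
  moreover have step: "(y \<tau> - 1 / ar) / (c * 1 / x \<tau>) * (c * a / ar) = (y \<tau> - 1 / ar) / \<tau>" for \<tau>
  proof -
    have "c * 1 / x \<tau> = c * a / ar * \<tau>" by (simp add: x_def)
    then show ?thesis using a ar c by simp
  qed
  ultimately have "((\<lambda>\<tau>. (y \<tau> - 1 / ar) / (c * 1 / x \<tau>) * (c * a / ar)) \<longlongrightarrow> 1 * (c * a / ar)) (at_right 0)"
    by (intro tendsto_mult tendsto_const)
  then
  show "((\<lambda>\<tau>. (y \<tau> - 1 / ar) / \<tau>) \<longlongrightarrow> c * a / ar) (at_right 0)"
    by (simp only: step mult_1)
qed

text \<open>Points \<open>y \<tau>\<close> slightly to the right of \<open>1 / ar\<close> carry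
  values of \<open>zfun\<close> close to \<open>a / ar\<close>. If \<open>ar < ar'\<close>, they
  also lie beyond \<open>1 / ar'\<close>, where \<open>zfun\<close> is capped by the smaller number
  \<open>a / ar'\<close>.\<close>

lemma admissible_not_less:
  assumes adm: "admissible a \<rho> zs ar \<epsilon> c" and adm': "admissible a \<rho> zs ar' \<epsilon>' c'" and a: "0 < a"
  shows "\<not> ar < ar'"
proof
  assume less: "ar < ar'"
  have ar: "0 < ar" "0 < c" using adm by (auto simp: admissible_def)
  obtain y where y: "\<forall>\<^sub>F \<tau> in at_right 0. y \<tau> \<in> V ar \<epsilon> \<and> zfun \<rho> zs (y \<tau>) = a / ar * (1 - \<tau>)"
    and y_lim: "((\<lambda>\<tau>. (y \<tau> - 1 / ar) / \<tau>) \<longlongrightarrow> c * a / ar) (at_right 0)"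
    using admissible_branch[OF adm a] by blast
  have "((\<lambda>\<tau>. a / ar * (1 - \<tau>)) \<longlongrightarrow> a / ar) (at_right 0)" using ar by (auto intro!: tendsto_eq_intros)
  moreover have "a / ar' < a / ar" using less a ar by (simp add: frac_less2)
  ultimately have "\<forall>\<^sub>F \<tau> in at_right 0. a / ar' < a / ar * (1 - \<tau>)" by (rule order_tendstoD)
  moreover have "\<forall>\<^sub>F \<tau> in at_right 0. 0 < (y \<tau> - 1 / ar) / \<tau>"
    using y_lim by (rule order_tendstoD) (use a ar in simp)
  ultimately have "\<forall>\<^sub>F \<tau> in at_right (0::real). False"
    using y eventually_at_right_less[of 0]
  proof eventually_elim
    case (elim \<tau>)
    have "1 / ar' < 1 / ar" using less ar by (simp add: frac_less2)
    also have "\<dots> < y \<tau>" using elim by (simp add: zero_less_divide_iff)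
    finally have "y \<tau> \<in> {1 / ar'<..1}" using elim adm by (auto simp: admissible_def)
    then have "zfun \<rho> zs (y \<tau>) \<le> a / ar'" using adm' by (auto simp: admissible_def)
    then show False using elim by simp
  qed
  then show False by simp
qed

lemma region_near_critical_point:
  assumes adm: "admissible a \<rho> zs ar \<epsilon> c" and sep: "separated_beyond a \<rho> zs ar \<epsilon>" and a: "0 < a"
  shows "\<exists>\<sigma>. (\<sigma> \<longlongrightarrow> 1) (at_right 0) \<and>
    (\<forall>\<^sub>F \<tau> in at_right 0. \<forall>s\<in>{0<..<1}.
      1 / ar * (1 - \<tau>) < s \<and> a / ar * (1 - \<tau>) < zfun \<rho> zs s \<longleftrightarrow>
      s - 1 / ar \<in> {- 1 / ar * \<tau> <..< c * a / ar * (\<sigma> \<tau> * \<tau>)})"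
proof -
  have ar: "1 < ar" "0 < c" "0 < \<epsilon>" and decr: "strict_antimono_on (V ar \<epsilon>) (zfun \<rho> zs)"
    using adm by (auto simp: admissible_def)
  obtain s0 where s0: "s0 < a / ar" "\<And>x. x \<in> {1 / ar + \<epsilon><..1} \<Longrightarrow> zfun \<rho> zs x \<le> s0"
    using sep by (auto simp: separated_beyond_def)
  obtain y where y: "\<forall>\<^sub>F \<tau> in at_right 0. y \<tau> \<in> V ar \<epsilon> \<and> zfun \<rho> zs (y \<tau>) = a / ar * (1 - \<tau>)"
    and y_lim: "((\<lambda>\<tau>. (y \<tau> - 1 / ar) / \<tau>) \<longlongrightarrow> c * a / ar) (at_right 0)"
    using admissible_branch[OF adm a] by blast
  define \<sigma> where "\<sigma> = (\<lambda>\<tau>. (y \<tau> - 1 / ar) / \<tau> / (c * a / ar))"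
  have "(\<sigma> \<longlongrightarrow> c * a / ar / (c * a / ar)) (at_right 0)"
    unfolding \<sigma>_def by (intro tendsto_intros y_lim) (use a ar in simp)
  then have "(\<sigma> \<longlongrightarrow> 1) (at_right 0)" using a ar by simp
  moreover have "\<forall>\<^sub>F \<tau> in at_right 0. \<forall>s\<in>{0<..<1}.
      1 / ar * (1 - \<tau>) < s \<and> a / ar * (1 - \<tau>) < zfun \<rho> zs s \<longleftrightarrow>
      s - 1 / ar \<in> {- 1 / ar * \<tau> <..< c * a / ar * (\<sigma> \<tau> * \<tau>)}"
  proof -
    have "((\<lambda>\<tau>. a / ar * (1 - \<tau>)) \<longlongrightarrow> a / ar) (at_right 0)" using ar by (auto intro!: tendsto_eq_intros)
    from order_tendstoD(1)[OF this s0(1)]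
    have "\<forall>\<^sub>F \<tau> in at_right 0. s0 < a / ar * (1 - \<tau>)" .
    \<comment> \<open>This smallness puts the lower bound \<open>1 / ar * (1 - \<tau>)\<close>
      inside \<open>V\<close>.\<close>
    moreover have "((\<lambda>\<tau>. 1 / ar * \<tau>) \<longlongrightarrow> 1 / ar * 0) (at_right 0)" by (intro tendsto_intros)
    then have "\<forall>\<^sub>F \<tau> in at_right 0. 1 / ar * \<tau> < \<epsilon>"
      by (rule order_tendstoD) (use ar in simp)
    ultimately show "\<forall>\<^sub>F \<tau> in at_right 0. \<forall>s\<in>{0<..<1}.
        1 / ar * (1 - \<tau>) < s \<and> a / ar * (1 - \<tau>) < zfun \<rho> zs s \<longleftrightarrow>
        s - 1 / ar \<in> {- 1 / ar * \<tau> <..< c * a / ar * (\<sigma> \<tau> * \<tau>)}"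
      using y eventually_at_right_less[of 0]
    proof eventually_elim
      case (elim \<tau>)
      have y_eq: "c * a / ar * (\<sigma> \<tau> * \<tau>) = y \<tau> - 1 / ar"
        using a ar elim by (simp add: \<sigma>_def)
      have low: "1 / ar * (1 - \<tau>) < s \<longleftrightarrow> - 1 / ar * \<tau> < s - 1 / ar" for s
        by (simp add: diff_divide_distrib algebra_simps)
      have "a / ar * (1 - \<tau>) < zfun \<rho> zs s \<longleftrightarrow> s < y \<tau>"
        if s: "s \<in> {0<..<1}" and lower: "1 / ar * (1 - \<tau>) < s" for s
      proof (cases "s \<le> 1 / ar + \<epsilon>")
        case True
        have "1 / ar - \<epsilon> \<le> 1 / ar * (1 - \<tau>)" using elim by (simp add: diff_divide_distrib algebra_simps)
        then have sV: "s \<in> V ar \<epsilon>" using True lower by (simp add: V_def)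
        show ?thesis
          using elim sV monotone_onD[OF decr, of s "y \<tau>"] monotone_onD[OF decr, of "y \<tau>" s]
          by (cases s "y \<tau>" rule: linorder_cases) auto
      next
        case False
        then have "zfun \<rho> zs s \<le> s0" using s by (intro s0) auto
        then have "\<not> a / ar * (1 - \<tau>) < zfun \<rho> zs s" using elim by simp
        moreover have "\<not> s < y \<tau>" using elim False by (auto simp: V_def)
        ultimately show ?thesis by simp
      qed
      then show ?case unfolding y_eq using low by auto
    qed
  qed
  ultimately show ?thesis by blast
qed

lemma slowly_varying_times_powr_regvar:
  fixes G L :: "real \<Rightarrow> real"
  assumes L: "slowly_varying_at_0 L" and G: "G \<sim>[at_right 0] (\<lambda>u. L u * u powr \<gamma>)" and t: "0 < t"
  shows "((\<lambda>u. G (t * u) / G u) \<longlongrightarrow> t powr \<gamma>) (at_right 0)"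
proof -
  have scale: "filterlim (\<lambda>u. t * u) (at_right 0) (at_right 0)"
    unfolding filterlim_at
  proof
    show "((\<lambda>u. t * u) \<longlongrightarrow> 0) (at_right 0)" by (auto intro!: tendsto_eq_intros)
    show "\<forall>\<^sub>F u in at_right 0. t * u \<in> {0<..} \<and> t * u \<noteq> 0"
      using eventually_at_right_less[of 0] by eventually_elim (use t in auto)
  qed
  have L_lim: "((\<lambda>u. L (t * u) / L u) \<longlongrightarrow> 1) (at_right 0)"
    using L t by (auto simp: slowly_varying_at_0_def)
  have "(\<lambda>u. G (t * u) / G u) \<sim>[at_right 0] (\<lambda>u. L (t * u) * (t * u) powr \<gamma> / (L u * u powr \<gamma>))"
    by (intro asymp_equiv_divide asymp_equiv_compose'[OF G scale] G)
  moreover have "((\<lambda>u. L (t * u) * (t * u) powr \<gamma> / (L u * u powr \<gamma>)) \<longlongrightarrow> t powr \<gamma>) (at_right 0)"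
  proof (rule Lim_transform_eventually)
    show "((\<lambda>u. L (t * u) / L u * t powr \<gamma>) \<longlongrightarrow> t powr \<gamma>) (at_right 0)"
      using tendsto_mult[OF L_lim tendsto_const] by simp
    show "\<forall>\<^sub>F u in at_right 0. L (t * u) / L u * t powr \<gamma> = L (t * u) * (t * u) powr \<gamma> / (L u * u powr \<gamma>)"
      using eventually_at_right_less[of 0] by eventually_elim (use t in \<open>simp add: powr_mult\<close>)
  qed
  ultimately show ?thesis using tendsto_asymp_equiv_cong by blast
qed

text \<open>Monotonicity propagates positivity near 0 to every positive argument.\<close>

lemma mono_regvarI:
  assumes mono: "\<And>s t. s \<le> t \<Longrightarrow> G s \<le> G t" and le_1: "\<And>t. G t \<le> 1"
    and pos: "\<forall>\<^sub>F u in at_right 0. 0 < G u"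
    and regvar: "\<And>t. 0 < t \<Longrightarrow> ((\<lambda>u. G (t * u) / G u) \<longlongrightarrow> t powr \<gamma>) (at_right 0)"
  shows "mono_regvar G \<gamma>"
proof
  fix t :: real assume t: "0 < t"
  have "\<forall>\<^sub>F u in at_right 0. 0 < G u \<and> u < t"
    using pos eventually_at_right_real[OF t] by eventually_elim auto
  then obtain u where "0 < G u" "u < t"
    using eventually_happens'[OF trivial_limit_at_right_real] by blast
  then show "0 < G t" using mono[of u t] by simp
qed (use assms in auto)

text \<open>The hypothesis concerns the exact intervals $(K_1 u, K_2 u)$, which are nested since
  $K_1 < 0 < K_2$; their probability \<open>G\<close> is monotone and regularly varying. The true
  region has a perturbed right end, and \<open>H\<close> is compared with \<open>G\<close> by
  monotonicity.\<close>

lemma (in prob_space) region_probability: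
  fixes W :: "'a \<Rightarrow> real" and L :: "real \<Rightarrow> real"
  assumes W[measurable]: "random_variable borel W"
    and zW[measurable]: "random_variable borel (\<lambda>\<omega>. zfun \<rho> zs (W \<omega>))"
    and W01: "\<And>\<omega>. \<omega> \<in> space M \<Longrightarrow> W \<omega> \<in> {0<..<1}"
    and adm: "admissible a \<rho> zs ar \<epsilon> c" and sep: "separated_beyond a \<rho> zs ar \<epsilon>" and a: "0 < a"
    and L: "slowly_varying_at_0 L"
    and G: "(\<lambda>u. prob {\<omega>\<in>space M. W \<omega> - 1 / ar \<in> {- 1 / ar * u <..< c * a / ar * u}})
           \<sim>[at_right 0] (\<lambda>u. L u * u powr \<gamma>)"
  defines "H \<equiv> \<lambda>\<tau>. prob {\<omega>\<in>space M. 1 / ar * (1 - \<tau>) < W \<omega> \<and> a / ar * (1 - \<tau>) < zfun \<rho> zs (W \<omega>)}"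
  shows "\<tau> \<le> 0 \<Longrightarrow> H \<tau> = 0" and "mono_regvar H \<gamma>"
    and "((\<lambda>u. H u / (L u * u powr \<gamma>)) \<longlongrightarrow> 1) (at_right 0)"
proof -
  have ar: "1 < ar" "0 < c" and level: "\<And>x. x \<in> {1 / ar<..1} \<Longrightarrow> zfun \<rho> zs x \<le> a / ar"
    using adm by (auto simp: admissible_def)
  show "H \<tau> = 0" if "\<tau> \<le> 0" for \<tau>
  proof -
    have "\<not> (1 / ar * (1 - \<tau>) < W \<omega> \<and> a / ar * (1 - \<tau>) < zfun \<rho> zs (W \<omega>))" if \<omega>: "\<omega> \<in> space M" for \<omega>
    proof safe
      assume *: "1 / ar * (1 - \<tau>) < W \<omega>" "a / ar * (1 - \<tau>) < zfun \<rho> zs (W \<omega>)"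
      have "1 / ar * 1 \<le> 1 / ar * (1 - \<tau>)" "a / ar * 1 \<le> a / ar * (1 - \<tau>)"
        using ar a \<open>\<tau> \<le> 0\<close> by (intro mult_left_mono; simp)+
      then show False using * W01[OF \<omega>] level[of "W \<omega>"] by auto
    qed
    then have "{\<omega>\<in>space M. 1 / ar * (1 - \<tau>) < W \<omega> \<and> a / ar * (1 - \<tau>) < zfun \<rho> zs (W \<omega>)} = {}"
      by blast
    then show ?thesis unfolding H_def by (simp only: measure_empty)
  qed
  define G where "G = (\<lambda>u. prob {\<omega>\<in>space M. W \<omega> - 1 / ar \<in> {- 1 / ar * u <..< c * a / ar * u}})"
  have G_equiv: "G \<sim>[at_right 0] (\<lambda>u. L u * u powr \<gamma>)" unfolding G_def by (rule G)
  have pos: "\<forall>\<^sub>F u in at_right 0. 0 < L u * u powr \<gamma>"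
    using L eventually_at_right_less[of 0] unfolding slowly_varying_at_0_def
    by (auto elim: eventually_elim2)
  have G_lim: "((\<lambda>u. G u / (L u * u powr \<gamma>)) \<longlongrightarrow> 1) (at_right 0)"
    by (rule asymp_equivD_strong[OF G_equiv]) (use pos in \<open>auto elim!: eventually_mono\<close>)
  have "\<forall>\<^sub>F u in at_right 0. 0 < G u / (L u * u powr \<gamma>)"
    using G_lim by (rule order_tendstoD) simp
  then have G_pos: "\<forall>\<^sub>F u in at_right 0. 0 < G u"
    using pos by eventually_elim (simp add: zero_less_divide_iff)
  have G_mono: "G s \<le> G t" if "s \<le> t" for s t
  proof -
    have "- (1 / ar) * t \<le> - (1 / ar) * s"
      using that ar by (intro mult_left_mono_neg) auto
    moreover have "c * a / ar * s \<le> c * a / ar * t" using that ar a by (intro mult_left_mono) auto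
    ultimately show ?thesis unfolding G_def by (intro finite_measure_mono) auto
  qed
  interpret G: mono_regvar G \<gamma>
  proof (rule mono_regvarI[OF G_mono _ G_pos])
    show "G t \<le> 1" for t unfolding G_def by (rule prob_le_1)
    show "0 < t \<Longrightarrow> ((\<lambda>u. G (t * u) / G u) \<longlongrightarrow> t powr \<gamma>) (at_right 0)" for t
      by (rule slowly_varying_times_powr_regvar[OF L G_equiv])
  qed
  obtain \<sigma> where \<sigma>: "(\<sigma> \<longlongrightarrow> 1) (at_right 0)"
    and region: "\<forall>\<^sub>F \<tau> in at_right 0. \<forall>s\<in>{0<..<1}.
      1 / ar * (1 - \<tau>) < s \<and> a / ar * (1 - \<tau>) < zfun \<rho> zs s \<longleftrightarrow>
      s - 1 / ar \<in> {- 1 / ar * \<tau> <..< c * a / ar * (\<sigma> \<tau> * \<tau>)}"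
    using region_near_critical_point[OF adm sep a] by blast
  \<comment> \<open>The left end of the region is scaled by 1, the right end by
    \<open>\<sigma> \<tau>\<close>. Using the smaller or the larger factor at both ends gives an
    interval of the exact form inside or around it.\<close>
  have sandwich: "\<forall>\<^sub>F \<tau> in at_right 0. G (min 1 (\<sigma> \<tau>) * \<tau>) \<le> H \<tau> \<and> H \<tau> \<le> G (max 1 (\<sigma> \<tau>) * \<tau>)"
    using region order_tendstoD(1)[OF \<sigma>, of 0, simplified] eventually_at_right_less[of 0]
  proof eventually_elim
    case (elim \<tau>)
    have H_eq: "H \<tau> = prob {\<omega>\<in>space M. W \<omega> - 1 / ar \<in> {- 1 / ar * \<tau> <..< c * a / ar * (\<sigma> \<tau> * \<tau>)}}"
      unfolding H_def using elim(1) W01 by (intro arg_cong[where f = prob] Collect_cong conj_cong refl) blast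
    have K: "- (1 / ar) * (max 1 (\<sigma> \<tau>) * \<tau>) \<le> - (1 / ar) * \<tau>" "- (1 / ar) * \<tau> \<le> - (1 / ar) * (min 1 (\<sigma> \<tau>) * \<tau>)"
      "c * a / ar * (min 1 (\<sigma> \<tau>) * \<tau>) \<le> c * a / ar * (\<sigma> \<tau> * \<tau>)"
      "c * a / ar * (\<sigma> \<tau> * \<tau>) \<le> c * a / ar * (max 1 (\<sigma> \<tau>) * \<tau>)"
      using elim ar a by (auto intro!: mult_left_mono mult_left_mono_neg mult_right_mono simp: divide_right_mono)
    show ?case
      unfolding H_eq G_def by (intro conjI finite_measure_mono) (use K in auto)
  qed
  have id: "filterlim (\<lambda>u. u) (at_right (0::real)) (at_right 0)" by (rule filterlim_ident)
  have lower: "((\<lambda>u. G (min 1 (\<sigma> u) * u) / G u) \<longlongrightarrow> 1) (at_right 0)"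
    using G.locally_uniform[OF id tendsto_min[OF tendsto_const \<sigma>, of 1]] by simp
  have upper: "((\<lambda>u. G (max 1 (\<sigma> u) * u) / G u) \<longlongrightarrow> 1) (at_right 0)"
    using G.locally_uniform[OF id tendsto_max[OF tendsto_const \<sigma>, of 1]] by simp
  have HG: "((\<lambda>u. H u / G u) \<longlongrightarrow> 1) (at_right 0)"
  proof (rule tendsto_sandwich[OF _ _ lower upper])
    show "\<forall>\<^sub>F u in at_right 0. G (min 1 (\<sigma> u) * u) / G u \<le> H u / G u"
      using sandwich G_pos by eventually_elim (simp add: divide_right_mono)
    show "\<forall>\<^sub>F u in at_right 0. H u / G u \<le> G (max 1 (\<sigma> u) * u) / G u"
      using sandwich G_pos by eventually_elim (simp add: divide_right_mono)
  qed
  show H_lim: "((\<lambda>u. H u / (L u * u powr \<gamma>)) \<longlongrightarrow> 1) (at_right 0)"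
  proof (rule Lim_transform_eventually)
    show "((\<lambda>u. H u / G u * (G u / (L u * u powr \<gamma>))) \<longlongrightarrow> 1) (at_right 0)"
      using tendsto_mult[OF HG G_lim] by simp
    show "\<forall>\<^sub>F u in at_right 0. H u / G u * (G u / (L u * u powr \<gamma>)) = H u / (L u * u powr \<gamma>)"
      using G_pos by eventually_elim simp
  qed
  show "mono_regvar H \<gamma>"
  proof (rule mono_regvarI)
    show "H s \<le> H t" if "s \<le> t" for s t
    proof -
      have "1 / ar * (1 - t) \<le> 1 / ar * (1 - s)" "a / ar * (1 - t) \<le> a / ar * (1 - s)"
        using ar a that by (intro mult_left_mono; simp)+
      then show ?thesis unfolding H_def by (intro finite_measure_mono) auto
    qed
    show "H t \<le> 1" for t unfolding H_def by (rule prob_le_1)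
    have "\<forall>\<^sub>F u in at_right 0. 0 < H u / (L u * u powr \<gamma>)"
      using H_lim by (rule order_tendstoD) simp
    then show "\<forall>\<^sub>F u in at_right 0. 0 < H u"
      using pos by eventually_elim (simp add: zero_less_divide_iff)
    show "((\<lambda>u. H (t * u) / H u) \<longlongrightarrow> t powr \<gamma>) (at_right 0)" if "0 < t" for t
      by (rule slowly_varying_times_powr_regvar[OF L asymp_equivI'[OF H_lim] that])
  qed
qed

section \<open>Tail asymptotics\<close>

text \<open>Divided by \<open>prob E\<close>, the product formula says that conditionally on
  \<open>E\<close> the pair has the product of the unconditional marginals as its law. Integrating
  the probabilities of the sections of \<open>B\<close> then gives the claim.\<close>

lemma (in prob_space) prob_pair_independent:
  fixes R W :: "'a \<Rightarrow> real" and B :: "(real \<times> real) set"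
  assumes E: "E \<in> events" "0 < prob E"
    and R[measurable]: "random_variable borel R" and W[measurable]: "random_variable borel W"
    and indep: "\<And>A B. A \<in> sets borel \<Longrightarrow> B \<in> sets borel \<Longrightarrow>
      prob (E \<inter> (R -` A \<inter> space M) \<inter> (W -` B \<inter> space M)) =
      prob E * prob (R -` A \<inter> space M) * prob (W -` B \<inter> space M)"
    and B: "B \<in> sets borel"
  shows "prob {\<omega>\<in>E. (R \<omega>, W \<omega>) \<in> B} =
    prob E * (\<integral>r. prob {\<omega>\<in>space M. (r, W \<omega>) \<in> B} \<partial>distr M borel R)"
proof -
  have B'[measurable]: "B \<in> sets (borel \<Otimes>\<^sub>M borel)" using B by (subst borel_prod)
  have nz: "emeasure M E \<noteq> 0" using E by (simp add: emeasure_eq_measure)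
  interpret R: prob_space "distr M borel R" by (rule prob_space_distr) simp
  interpret W: prob_space "distr M borel W" by (rule prob_space_distr) simp
  interpret U: prob_space "uniform_measure M E"
    using nz by (intro prob_space_uniform_measure) (auto simp: emeasure_eq_measure)
  have "distr M borel R \<Otimes>\<^sub>M distr M borel W =
      distr (uniform_measure M E) (borel \<Otimes>\<^sub>M borel) (\<lambda>\<omega>. (R \<omega>, W \<omega>))"
  proof (rule pair_measure_eqI)
    fix A C assume "A \<in> sets (distr M borel R)" "C \<in> sets (distr M borel W)"
    then have [measurable]: "A \<in> sets borel" "C \<in> sets borel" by auto
    have "emeasure (distr (uniform_measure M E) (borel \<Otimes>\<^sub>M borel) (\<lambda>\<omega>. (R \<omega>, W \<omega>))) (A \<times> C) =
        ennreal (prob (E \<inter> ((\<lambda>\<omega>. (R \<omega>, W \<omega>)) -` (A \<times> C) \<inter> space M)) / prob E)"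
      using nz E by (subst emeasure_distr) (auto simp: U.emeasure_eq_measure emeasure_eq_measure)
    also have "E \<inter> ((\<lambda>\<omega>. (R \<omega>, W \<omega>)) -` (A \<times> C) \<inter> space M) =
        E \<inter> (R -` A \<inter> space M) \<inter> (W -` C \<inter> space M)" by auto
    also have "prob \<dots> / prob E = prob (R -` A \<inter> space M) * prob (W -` C \<inter> space M)"
      using E by (subst indep) auto
    finally show "emeasure (distr M borel R) A * emeasure (distr M borel W) C =
        emeasure (distr (uniform_measure M E) (borel \<Otimes>\<^sub>M borel) (\<lambda>\<omega>. (R \<omega>, W \<omega>))) (A \<times> C)"
      by (simp add: emeasure_distr emeasure_eq_measure ennreal_mult)
  qed (use R.sigma_finite_measure_axioms W.sigma_finite_measure_axioms in \<open>auto intro: sets_pair_measure_cong\<close>)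
  moreover have slice: "W -` Pair r -` B \<inter> space M = {\<omega>\<in>space M. (r, W \<omega>) \<in> B}" for r
    by auto
  ultimately have "emeasure (distr (uniform_measure M E) (borel \<Otimes>\<^sub>M borel) (\<lambda>\<omega>. (R \<omega>, W \<omega>))) B =
      (\<integral>\<^sup>+r. emeasure (distr M borel W) (Pair r -` B) \<partial>distr M borel R)"
    by (subst W.emeasure_pair_measure_alt[symmetric]) (auto simp: borel_prod B cong: sets_pair_measure_cong)
  also have "(\<lambda>r. emeasure (distr M borel W) (Pair r -` B)) = (\<lambda>r. ennreal (prob {\<omega>\<in>space M. (r, W \<omega>) \<in> B}))"
    by (simp add: emeasure_distr emeasure_eq_measure slice)
  also have "(\<integral>\<^sup>+r. ennreal (prob {\<omega>\<in>space M. (r, W \<omega>) \<in> B}) \<partial>distr M borel R) =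
      ennreal (\<integral>r. prob {\<omega>\<in>space M. (r, W \<omega>) \<in> B} \<partial>distr M borel R)"
  proof (rule nn_integral_eq_integral)
    have "(\<lambda>r. measure (distr M borel W) (Pair r -` B)) \<in> borel_measurable borel"
      by measurable
    also have "(\<lambda>r. measure (distr M borel W) (Pair r -` B)) = (\<lambda>r. prob {\<omega>\<in>space M. (r, W \<omega>) \<in> B})"
      by (simp add: measure_distr slice)
    finally show "integrable (distr M borel R) (\<lambda>r. prob {\<omega>\<in>space M. (r, W \<omega>) \<in> B})"
      by (intro R.integrable_const_bound[where B = 1]) auto
  qed auto
  also have "emeasure (distr (uniform_measure M E) (borel \<Otimes>\<^sub>M borel) (\<lambda>\<omega>. (R \<omega>, W \<omega>))) B =
      ennreal (prob (E \<inter> ((\<lambda>\<omega>. (R \<omega>, W \<omega>)) -` B \<inter> space M)) / prob E)"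
    using nz E by (subst emeasure_distr) (auto simp: U.emeasure_eq_measure emeasure_eq_measure)
  also have "E \<inter> ((\<lambda>\<omega>. (R \<omega>, W \<omega>)) -` B \<inter> space M) = {\<omega>\<in>E. (R \<omega>, W \<omega>) \<in> B}"
    using sets.sets_into_space[OF E(1)] by auto
  finally show ?thesis
    using E by (subst (asm) ennreal_inj) (auto simp: field_simps intro!: integral_nonneg_AE divide_nonneg_nonneg)
qed

text \<open>Here \<open>s\<close> and \<open>t\<close> stand for W and z*(W). Since
  \<open>s < 1\<close> and \<open>t > 0\<close>, the inequality forces
  \<open>a * x < \<bar>\<rho>\<bar> * r\<close>, so \<open>k\<close> is
  \<open>a / (\<bar>\<rho>\<bar> * ar)\<close>; it exceeds 1 exactly because
  \<open>ar < a / \<bar>\<rho>\<bar>\<close>. For \<open>\<rho> = 0\<close> the inequality is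
  impossible and any \<open>k > 1\<close> will do.\<close>

lemma opposite_sign_bound:
  fixes a \<rho> ar :: real
  assumes "0 < a" "0 < ar" "\<rho> \<noteq> 0 \<longrightarrow> ar < a / \<bar>\<rho>\<bar>"
  obtains k where "1 < k"
    and "\<And>x r s t. 0 < x \<Longrightarrow> 0 < r \<Longrightarrow> 0 < s \<Longrightarrow> s < 1 \<Longrightarrow> 0 < t \<Longrightarrow>
      a * x < \<rho> * r * s - r * t \<Longrightarrow> k * (ar * x) < r"
proof (cases "\<rho> = 0")
  case True
  show thesis
  proof (rule that[of 2])
    fix x r s t :: real assume *: "0 < x" "0 < r" "0 < t" "a * x < \<rho> * r * s - r * t"
    have "0 < a * x" "0 < r * t" using * assms by auto
    moreover have "a * x < - (r * t)" using * True by simp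
    ultimately have False by linarith
    then show "2 * (ar * x) < r" ..
  qed simp
next
  case False
  show thesis
  proof (rule that[of "a / (\<bar>\<rho>\<bar> * ar)"])
    show "1 < a / (\<bar>\<rho>\<bar> * ar)" using assms False by (simp add: field_simps)
    fix x r s t :: real
    assume *: "0 < x" "0 < r" "0 < s" "s < 1" "0 < t" "a * x < \<rho> * r * s - r * t"
    have "a * x < \<rho> * r * s" using * by (smt (verit) mult_pos_pos)
    also have "\<dots> \<le> \<bar>\<rho>\<bar> * (r * s)" using * by (simp add: mult.assoc mult_right_mono)
    also have "\<dots> \<le> \<bar>\<rho>\<bar> * (r * 1)" using * by (intro mult_left_mono) auto
    finally show "a / (\<bar>\<rho>\<bar> * ar) * (ar * x) < r" using assms False by (simp add: field_simps)
  qed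
qed

text \<open>The Potter bound between \<open>1 / v\<close> and the fixed point \<open>u0\<close>. It
  limits the normalisation of the error term to polynomial growth in v, which rapid variation of the
  tail overcomes.\<close>

lemma (in mono_regvar) reciprocal_power_bound:
  "\<exists>C q. \<forall>\<^sub>F v in at_top. 1 / G (1 / v) \<le> C * v ^ q"
proof -
  obtain u0 C q where u0: "0 < u0" "0 < C"
    and potter: "\<And>u T. 0 < u \<Longrightarrow> u \<le> u0 \<Longrightarrow> 1 \<le> T \<Longrightarrow> G (T * u) \<le> C * T ^ q * G u"
    using potter by blast
  have "\<forall>\<^sub>F v in at_top. 1 / G (1 / v) \<le> C * u0 ^ q / G u0 * v ^ q"
    using eventually_ge_at_top[of "1 / u0"]
  proof eventually_elim
    case (elim v)
    have v: "0 < v" using elim u0 by (smt (verit) divide_pos_pos)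
    have "G ((u0 * v) * (1 / v)) \<le> C * (u0 * v) ^ q * G (1 / v)"
      using elim u0 v by (intro potter) (auto simp: field_simps)
    then have "G u0 \<le> C * u0 ^ q * v ^ q * G (1 / v)"
      using v by (simp add: power_mult_distrib mult_ac)
    then show ?case using G_pos[OF u0(1)] G_pos[of "1 / v"] v by (simp add: field_simps)
  qed
  then show ?thesis by blast
qed

lemma gumbel_tail_of_GMDA:
  assumes "prob_space N" and R: "R \<in> borel_measurable N" and R_pos: "\<forall>\<omega>\<in>space N. 0 < R \<omega>"
    and F: "F = cdf (distr N borel R)" and F_end: "upper_endpoint F = \<infinity>"
    and w: "\<forall>x>0. 0 < w x" and gmda: "GMDA F w"
  shows "gumbel_tail (\<lambda>x. measure (distr N borel R) {x<..}) w"
    and "measure (distr N borel R) {x<..} = 1 - F x"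
proof -
  interpret prob_space N by fact
  interpret \<mu>: real_distribution "distr N borel R" using R by simp
  show S: "\<mu>.prob {x<..} = 1 - F x" for x
    using \<mu>.prob_compl[of "{..x}"] by (simp add: F cdf_def flip: Compl_eq_Diff_UNIV)
  have F_mono: "x \<le> y \<Longrightarrow> F x \<le> F y" for x y
    unfolding F by (rule \<mu>.cdf_nondecreasing)
  show "gumbel_tail (\<lambda>x. \<mu>.prob {x<..}) w"
  proof
    show "\<mu>.prob {y<..} \<le> \<mu>.prob {x<..}" if "x \<le> y" for x y
      using F_mono[OF that] by (simp add: S)
    show "0 < \<mu>.prob {x<..}" for x
    proof -
      have "ereal x < Sup {ereal x |x. F x < 1}" using F_end by (simp add: upper_endpoint_def)
      then obtain y where "F y < 1" "x < y" by (auto simp: less_Sup_iff)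
      then show ?thesis using F_mono[of x y] by (simp add: S)
    qed
    show "\<mu>.prob {x<..} = 1" if "x \<le> 0" for x
    proof -
      have "R -` {..x} \<inter> space N = {}" using R_pos that by force
      then show ?thesis using R by (simp add: S F cdf_def measure_distr)
    qed
    have "((\<lambda>x. 1 - F x) \<longlongrightarrow> 1 - 1) at_top"
      unfolding F by (intro tendsto_intros \<mu>.cdf_lim_at_top_prob)
    then show "((\<lambda>x. \<mu>.prob {x<..}) \<longlongrightarrow> 0) at_top" by (simp add: S)
    show "((\<lambda>x. \<mu>.prob {x + t / w x<..} / \<mu>.prob {x<..}) \<longlongrightarrow> exp (- t)) at_top" for t
      using gmda by (simp add: S GMDA_def)
  qed (use w in auto)
qed

theorem proposition2:
  fixes M :: "'a measure" and N :: "'b measure"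
    and X Y :: "'a \<Rightarrow> real"
    and R W I1 I2 :: "'b \<Rightarrow> real"
    and F w zs L :: "real \<Rightarrow> real"
    and a \<rho> ar \<epsilon> c \<gamma> :: real
  assumes "prob_space M" and "prob_space N"
    and "X \<in> borel_measurable M" and "Y \<in> borel_measurable M"
    and "R \<in> borel_measurable N" and "W \<in> borel_measurable N"
    and "I1 \<in> borel_measurable N" and "I2 \<in> borel_measurable N"
    and "-1 < \<rho>" and "\<rho> < 1"
    and "distr M borel (\<lambda>\<omega>. (X \<omega>, Y \<omega>)) =
         distr N borel (\<lambda>\<omega>. (R \<omega> * I1 \<omega> * W \<omega>,
                              \<rho> * R \<omega> * I1 \<omega> * W \<omega> + R \<omega> * I2 \<omega> * zs (W \<omega>)))"
    and "prob_space.indep_sets N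
           (\<lambda>i. [rv_events N (\<lambda>\<omega>. (I1 \<omega>, I2 \<omega>)), rv_events N R, rv_events N W] ! i) {..<3::nat}"
    and "\<forall>\<omega>\<in>space N. R \<omega> > 0"
    and "\<forall>\<omega>\<in>space N. W \<omega> \<in> {0<..<1}"
    and "\<forall>\<omega>\<in>space N. I1 \<omega> \<in> {-1, 1} \<and> I2 \<omega> \<in> {-1, 1}"
    and "measure N {\<omega>\<in>space N. I1 \<omega> = 1 \<and> I2 \<omega> = 1} \<in> {0<..1}"
    and "zs \<in> borel_measurable (restrict_space borel {0..1})"
    and "\<forall>x\<in>{0..1}. 0 < zs x \<and> zs x \<le> 1"
    and "F = cdf (distr N borel R)"
    and "upper_endpoint F = \<infinity>"
    and "upper_endpoint (cdf (distr N borel W)) = 1"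
    and "0 < a" and "a \<le> 1"
    and "admissible a \<rho> zs ar \<epsilon> c"
    and "separated_beyond a \<rho> zs ar \<epsilon>"
    and "\<forall>x>0. w x > 0"
    and "GMDA F w"
    and "0 \<le> \<gamma>"
    and "locally_bounded_on {0<..} L" and "slowly_varying_at_0 L"
    and "(\<lambda>u. measure N {\<omega>\<in>space N. W \<omega> - 1 / ar \<in> {(- 1 / ar) * u <..< (c * a / ar) * u}})
           \<sim>[at_right 0] (\<lambda>u. L u * u powr \<gamma>)"
  shows "(\<forall>ar' \<epsilon>' c'. admissible a \<rho> zs ar' \<epsilon>' c' \<longrightarrow> ar' = ar) \<and>
         (let v = (\<lambda>x. x * w x) in
          (\<lambda>x. measure M {\<omega>\<in>space M. X \<omega> > x \<and> Y \<omega> > a * x})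
            \<sim>[at_top]
          (\<lambda>x. measure N {\<omega>\<in>space N. I1 \<omega> = 1 \<and> I2 \<omega> = 1} * Gamma (\<gamma> + 1) *
                L (1 / v (ar * x)) * ((1 - F (ar * x)) / v (ar * x) powr \<gamma>)))"
proof -
  interpret M: prob_space M by fact
  interpret prob_space N by fact
  have [measurable]: "X \<in> borel_measurable M" "Y \<in> borel_measurable M" "R \<in> borel_measurable N"
    "W \<in> borel_measurable N" "I1 \<in> borel_measurable N" "I2 \<in> borel_measurable N" by fact+
  note a = \<open>0 < a\<close> and adm = \<open>admissible a \<rho> zs ar \<epsilon> c\<close> and sep = \<open>separated_beyond a \<rho> zs ar \<epsilon>\<close>
  have R_pos: "0 < R \<omega>" and W01: "W \<omega> \<in> {0<..<1}" and signs: "I1 \<omega> \<in> {-1, 1}" "I2 \<omega> \<in> {-1, 1}"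
    and zs_pos: "0 < zs (W \<omega>)" if "\<omega> \<in> space N" for \<omega>
    using assms that by auto
  have ar: "1 < ar" and ar': "\<rho> \<noteq> 0 \<longrightarrow> ar < a / \<bar>\<rho>\<bar>"
    using adm by (auto simp: admissible_def)

  \<comment> \<open>\<open>zs\<close> is Borel only on [0,1]. Cutting it off to 0 elsewhere gives a
    Borel function on the line with the same values along \<open>W\<close>, which stays in
    (0,1).\<close>
  define zb where "zb = (\<lambda>s. \<rho> * s + indicator {0..1} s *\<^sub>R zs s)"
  have "(\<lambda>s. indicator {0..1} s *\<^sub>R zs s) \<in> borel_measurable borel"
    using \<open>zs \<in> borel_measurable (restrict_space borel {0..1})\<close>
    by (subst (asm) borel_measurable_restrict_space_iff) auto
  then have zb[measurable]: "zb \<in> borel_measurable borel" by (simp add: zb_def)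
  have zb_eq: "zb (W \<omega>) = zfun \<rho> zs (W \<omega>)" if "\<omega> \<in> space N" for \<omega>
    using W01[OF that] by (simp add: zb_def zfun_def)
  have zW[measurable]: "(\<lambda>\<omega>. zfun \<rho> zs (W \<omega>)) \<in> borel_measurable N"
    by (rule measurable_cong[THEN iffD1, of _ "\<lambda>\<omega>. zb (W \<omega>)"]) (auto simp: zb_eq)
  have "(\<lambda>\<omega>. zfun \<rho> zs (W \<omega>) - \<rho> * W \<omega>) \<in> borel_measurable N" by measurable
  then have zsW[measurable]: "(\<lambda>\<omega>. zs (W \<omega>)) \<in> borel_measurable N" by (simp add: zfun_def)

  define \<mu> where "\<mu> = distr N borel R"
  have \<mu>: "real_distribution \<mu>" by (simp add: \<mu>_def)
  have tail: "gumbel_tail (\<lambda>x. measure \<mu> {x<..}) w" and F_eq: "measure \<mu> {x<..} = 1 - F x" for x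
    using gumbel_tail_of_GMDA[of N R F w] assms unfolding \<mu>_def by auto
  interpret gumbel_tail "\<lambda>x. measure \<mu> {x<..}" w by (rule tail)
  define H where "H = (\<lambda>\<tau>. prob {\<omega>\<in>space N. 1 / ar * (1 - \<tau>) < W \<omega> \<and> a / ar * (1 - \<tau>) < zfun \<rho> zs (W \<omega>)})"
  note region_thms = region_probability[OF \<open>W \<in> borel_measurable N\<close> zW W01 adm sep a \<open>slowly_varying_at_0 L\<close> assms(31)]
  have region: "\<tau> \<le> 0 \<Longrightarrow> H \<tau> = 0" "mono_regvar H \<gamma>"
    "((\<lambda>u. H u / (L u * u powr \<gamma>)) \<longlongrightarrow> 1) (at_right 0)" for \<tau>
    unfolding H_def by (rule region_thms; assumption?)+
  interpret H: mono_regvar H \<gamma> by (rule region(2))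

  \<comment> \<open>Equal signs: reduction to an integral over the law of R\<close>
  define E where "E = {\<omega>\<in>space N. I1 \<omega> = 1 \<and> I2 \<omega> = 1}"
  have E[measurable]: "E \<in> events" by (simp add: E_def)
  have E_pos: "0 < prob E" using assms by (auto simp: E_def)
  have indep: "prob (E \<inter> (R -` A \<inter> space N) \<inter> (W -` B \<inter> space N)) =
      prob E * prob (R -` A \<inter> space N) * prob (W -` B \<inter> space N)"
    if "A \<in> sets borel" "B \<in> sets borel" for A B
  proof -
    have three: "{..<3::nat} = {0, 1, 2}" by auto
    have "E = (\<lambda>\<omega>. (I1 \<omega>, I2 \<omega>)) -` {(1, 1)} \<inter> space N" by (auto simp: E_def)
    moreover have "{(1, 1)} \<in> sets (borel :: (real \<times> real) measure)" by simp
    ultimately have "E \<in> rv_events N (\<lambda>\<omega>. (I1 \<omega>, I2 \<omega>))"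
      unfolding rv_events_def mem_Collect_eq by (intro exI[of _ "{(1, 1)}"] conjI)
    moreover have "R -` A \<inter> space N \<in> rv_events N R" "W -` B \<inter> space N \<in> rv_events N W"
      using that by (auto simp: rv_events_def)
    ultimately have "prob (\<Inter>i\<in>{..<3::nat}. [E, R -` A \<inter> space N, W -` B \<inter> space N] ! i) =
        (\<Prod>i\<in>{..<3::nat}. prob ([E, R -` A \<inter> space N, W -` B \<inter> space N] ! i))"
      by (intro indep_setsD[OF assms(12)]) (auto simp: three)
    then show ?thesis by (simp add: three Int_assoc mult.assoc)
  qed

  define J where "J = (\<lambda>y. \<integral>r. H (1 - y / r) * indicator {y<..} r \<partial>\<mu>)"
  have same_sign: "prob {\<omega>\<in>E. x < R \<omega> * W \<omega> \<and> a * x < R \<omega> * zfun \<rho> zs (W \<omega>)} = prob E * J (ar * x)"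
    if x: "0 < x" for x
  proof -
    define B where "B = {(r, s). x < r * s \<and> a * x < r * zb s}"
    have "{p \<in> space (borel \<Otimes>\<^sub>M borel). x < fst p * snd p \<and> a * x < fst p * zb (snd p)} \<in> sets (borel \<Otimes>\<^sub>M borel)"
      by measurable
    also have "{p \<in> space (borel \<Otimes>\<^sub>M borel). x < fst p * snd p \<and> a * x < fst p * zb (snd p)} = B"
      by (auto simp: B_def space_pair_measure)
    finally have B: "B \<in> sets borel" by (subst (asm) borel_prod)
    have "{\<omega>\<in>E. x < R \<omega> * W \<omega> \<and> a * x < R \<omega> * zfun \<rho> zs (W \<omega>)} = {\<omega>\<in>E. (R \<omega>, W \<omega>) \<in> B}"
      by (auto simp: B_def E_def zb_eq)
    also have "prob \<dots> = prob E * (\<integral>r. prob {\<omega>\<in>space N. (r, W \<omega>) \<in> B} \<partial>\<mu>)"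
      unfolding \<mu>_def by (rule prob_pair_independent[OF E E_pos _ _ indep B]) (fact | assumption)+
    also have "(\<integral>r. prob {\<omega>\<in>space N. (r, W \<omega>) \<in> B} \<partial>\<mu>) = J (ar * x)"
      unfolding J_def
    proof (rule integral_cong_AE)
      have H_meas[measurable]: "H \<in> borel_measurable borel"
        by (rule borel_measurable_mono) (auto simp: mono_def H.G_mono)
      show "(\<lambda>r. H (1 - ar * x / r) * indicator {ar * x<..} r) \<in> borel_measurable \<mu>"
        by (simp add: \<mu>_def)
      interpret W: prob_space "distr N borel W" by (rule prob_space_distr) simp
      have [measurable]: "B \<in> sets (borel \<Otimes>\<^sub>M borel)" using B by (subst borel_prod)
      have slice: "W -` Pair r -` B \<inter> space N = {\<omega>\<in>space N. (r, W \<omega>) \<in> B}" for r by auto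
      have "(\<lambda>r. measure (distr N borel W) (Pair r -` B)) \<in> borel_measurable borel"
        by measurable
      also have "(\<lambda>r. measure (distr N borel W) (Pair r -` B)) = (\<lambda>r. prob {\<omega>\<in>space N. (r, W \<omega>) \<in> B})"
        by (simp add: measure_distr slice)
      finally show "(\<lambda>r. prob {\<omega>\<in>space N. (r, W \<omega>) \<in> B}) \<in> borel_measurable \<mu>"
        by (simp add: \<mu>_def)
      have "AE r in \<mu>. 0 < r"
        unfolding \<mu>_def by (subst AE_distr_iff) (auto simp: R_pos)
      then show "AE r in \<mu>. prob {\<omega>\<in>space N. (r, W \<omega>) \<in> B} = H (1 - ar * x / r) * indicator {ar * x<..} r"
      proof eventually_elim
        case (elim r)
        \<comment> \<open>With \<open>\<tau> = 1 - ar * x / r\<close> the two levels in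
          \<open>H\<close> become \<open>x / r\<close> and \<open>a * x / r\<close>, and positivity
          of \<open>r\<close> clears the denominators.\<close>
        have "1 / ar * (1 - (1 - ar * x / r)) = x / r" "a / ar * (1 - (1 - ar * x / r)) = a * x / r"
          using ar by simp_all
        then have "{\<omega>\<in>space N. (r, W \<omega>) \<in> B} = {\<omega>\<in>space N. 1 / ar * (1 - (1 - ar * x / r)) < W \<omega> \<and>
            a / ar * (1 - (1 - ar * x / r)) < zfun \<rho> zs (W \<omega>)}"
          using elim by (auto simp: B_def zb_eq pos_divide_less_eq mult.commute[of r])
        then have "prob {\<omega>\<in>space N. (r, W \<omega>) \<in> B} = H (1 - ar * x / r)" by (simp add: H_def)
        \<comment> \<open>Since \<open>H\<close> vanishes at nonpositive arguments, the indicator in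
          \<open>J\<close> costs nothing.\<close>
        moreover have "H (1 - ar * x / r) = 0" if "r \<le> ar * x"
          using that elim by (intro region(1)) (simp add: field_simps)
        ultimately show ?case by (auto split: split_indicator)
      qed
    qed
    finally show ?thesis .
  qed

  \<comment> \<open>Mixed signs: two-sided bound for the joint tail\<close>
  have ar_pos: "0 < ar" using ar by simp
  obtain k where k: "1 < k" and opposite: "\<And>x r s t. 0 < x \<Longrightarrow> 0 < r \<Longrightarrow> 0 < s \<Longrightarrow> s < 1 \<Longrightarrow> 0 < t \<Longrightarrow>
      a * x < \<rho> * r * s - r * t \<Longrightarrow> k * (ar * x) < r"
    by (rule opposite_sign_bound[OF a ar_pos ar']) (rule that)
  define P where "P = (\<lambda>x. measure M {\<omega>\<in>space M. X \<omega> > x \<and> Y \<omega> > a * x})"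
  have P_bounds: "prob E * J (ar * x) \<le> P x" "P x \<le> prob E * J (ar * x) + measure \<mu> {k * (ar * x)<..}"
    if x: "0 < x" for x
  proof -
    \<comment> \<open>\<open>X\<close> and \<open>Y\<close> are known only in law, so the event is
      written as the preimage of a quadrant and moved to \<open>N\<close> through the equality of
      the image measures.\<close>
    define A where "A = {(u, v). x < u \<and> a * x < v}"
    have A[measurable]: "A \<in> sets (borel :: (real \<times> real) measure)"
    proof -
      have "{x<..} \<times> {a * x<..} \<in> sets (borel :: (real \<times> real) measure)"
        by (intro borel_open open_Times open_greaterThan)
      also have "{x<..} \<times> {a * x<..} = A" by (auto simp: A_def)
      finally show ?thesis .
    qed
    define D where "D = {\<omega>\<in>space N. (R \<omega> * I1 \<omega> * W \<omega>, \<rho> * R \<omega> * I1 \<omega> * W \<omega> + R \<omega> * I2 \<omega> * zs (W \<omega>)) \<in> A}"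
    define D1 where "D1 = {\<omega>\<in>E. x < R \<omega> * W \<omega> \<and> a * x < R \<omega> * zfun \<rho> zs (W \<omega>)}"
    have "{\<omega>\<in>space M. X \<omega> > x \<and> Y \<omega> > a * x} = (\<lambda>\<omega>. (X \<omega>, Y \<omega>)) -` A \<inter> space M"
      by (auto simp: A_def)
    then have "P x = measure (distr M borel (\<lambda>\<omega>. (X \<omega>, Y \<omega>))) A"
      using A by (simp add: measure_distr P_def)
    also have "\<dots> = measure (distr N borel (\<lambda>\<omega>. (R \<omega> * I1 \<omega> * W \<omega>,
        \<rho> * R \<omega> * I1 \<omega> * W \<omega> + R \<omega> * I2 \<omega> * zs (W \<omega>)))) A"
      by (simp only: assms(11))
    also have "\<dots> = prob D"
      by (subst measure_distr) (auto simp: D_def intro!: arg_cong[where f = prob])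
    finally have P_eq: "P x = prob D" .
    have D_meas: "D \<in> events" "D1 \<in> events"
      unfolding D_def D1_def by measurable
    have D1: "prob D1 = prob E * J (ar * x)" unfolding D1_def by (rule same_sign[OF x])
    have R_tail: "prob {\<omega>\<in>space N. k * (ar * x) < R \<omega>} = measure \<mu> {k * (ar * x)<..}"
      unfolding \<mu>_def by (subst measure_distr) (auto intro!: arg_cong[where f = prob])
    have "D1 \<subseteq> D"
      by (auto simp: D1_def D_def E_def A_def zfun_def algebra_simps)
    then show "prob E * J (ar * x) \<le> P x"
      unfolding P_eq D1[symmetric] by (rule finite_measure_mono) (rule D_meas)
    \<comment> \<open>\<open>I1 = -1\<close> would make the first coordinate negative, against
      \<open>x > 0\<close>; \<open>I1 = 1\<close>, \<open>I2 = -1\<close> is the case covered by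
      \<open>opposite\<close>.\<close>
    have "D \<subseteq> D1 \<union> {\<omega>\<in>space N. k * (ar * x) < R \<omega>}"
    proof
      fix \<omega> assume "\<omega> \<in> D"
      then have \<omega>: "\<omega> \<in> space N" and first: "x < R \<omega> * I1 \<omega> * W \<omega>"
        and second: "a * x < \<rho> * R \<omega> * I1 \<omega> * W \<omega> + R \<omega> * I2 \<omega> * zs (W \<omega>)"
        by (auto simp: D_def A_def)
      have "0 < R \<omega> * W \<omega>" using R_pos[OF \<omega>] W01[OF \<omega>] by simp
      then have "I1 \<omega> = 1" using first x signs[OF \<omega>] by auto
      moreover have "k * (ar * x) < R \<omega>" if "I1 \<omega> = 1" "I2 \<omega> = - 1"
        using second that R_pos[OF \<omega>] W01[OF \<omega>] zs_pos[OF \<omega>] x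
        by (intro opposite[of x "R \<omega>" "W \<omega>" "zs (W \<omega>)"]) auto
      ultimately show "\<omega> \<in> D1 \<union> {\<omega>\<in>space N. k * (ar * x) < R \<omega>}"
        using signs[OF \<omega>] \<omega> first second by (auto simp: D1_def E_def zfun_def algebra_simps)
    qed
    then have "prob D \<le> prob (D1 \<union> {\<omega>\<in>space N. k * (ar * x) < R \<omega>})"
      by (rule finite_measure_mono) (use D_meas in measurable)
    also have "\<dots> \<le> prob D1 + prob {\<omega>\<in>space N. k * (ar * x) < R \<omega>}"
      by (rule measure_Un_le) (use D_meas in measurable)
    finally show "P x \<le> prob E * J (ar * x) + measure \<mu> {k * (ar * x)<..}"
      by (simp add: P_eq D1 R_tail)
  qed

  \<comment> \<open>Asymptotics of the bounds\<close>
  define v where "v = (\<lambda>x. x * w x)"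
  define S where "S = (\<lambda>x. measure \<mu> {x<..})"
  have S_gt_0: "0 < S x" for x unfolding S_def by (rule S_pos)
  have v_inf: "filterlim v at_top at_top" unfolding v_def by (rule v_at_top)
  have v_pos: "0 < v y" if "0 < y" for y using that w_pos by (simp add: v_def)
  \<comment> \<open>Normalising with \<open>H\<close> rather than with \<open>L\<close> lets the
    integral theorem apply directly; \<open>T_lim\<close> makes the exchange afterwards.\<close>
  define T where "T = (\<lambda>y. S y * H (1 / v y))"
  have T_pos: "0 < T y" if "0 < y" for y
    unfolding T_def using that S_gt_0 v_pos by (intro mult_pos_pos H.G_pos) auto
  have J_lim: "((\<lambda>y. J y / T y) \<longlongrightarrow> Gamma (\<gamma> + 1)) at_top"
    using integral_mono_regvar_gumbel_tail[OF \<mu> tail region(2) _ \<open>0 \<le> \<gamma>\<close>]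
    by (simp add: J_def T_def S_def v_def H_def)
  \<comment> \<open>The quotient splits into \<open>S (k * y) / S y\<close>, which beats every power
    of \<open>v y\<close>, and \<open>1 / H (1 / v y)\<close>, which is at most a power of
    it.\<close>
  have err_lim: "((\<lambda>y. S (k * y) / T y) \<longlongrightarrow> 0) at_top"
  proof -
    obtain C q where C: "\<forall>\<^sub>F v in at_top. 1 / H (1 / v) \<le> C * v ^ q"
      using H.reciprocal_power_bound by blast
    have bound: "\<forall>\<^sub>F y in at_top. norm (S (k * y) / T y) \<le> C * (S (k * y) / S y * v y ^ q)"
      using eventually_compose_filterlim[OF C v_inf] eventually_gt_at_top[of 0]
    proof eventually_elim
      case (elim y)
      have "S (k * y) / T y = S (k * y) / S y * (1 / H (1 / v y))" by (simp add: T_def)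
      also have "\<dots> \<le> S (k * y) / S y * (C * v y ^ q)"
        using elim S_gt_0[of y] S_gt_0[of "k * y"] by (intro mult_left_mono) auto
      finally show ?case
        using T_pos[OF elim(2)] S_gt_0[of "k * y"] by (simp add: mult_ac)
    qed
    have "((\<lambda>y. C * (S (k * y) / S y * v y ^ q)) \<longlongrightarrow> C * 0) at_top"
      unfolding S_def v_def by (intro tendsto_mult tendsto_const rapid_variation k)
    then show ?thesis by (intro Lim_null_comparison[OF bound]) simp
  qed
  have scale: "filterlim (\<lambda>x. ar * x) at_top at_top"
    by (rule filterlim_tendsto_pos_mult_at_top[OF tendsto_const _ filterlim_ident]) (use ar in simp)
  have P_lim: "((\<lambda>x. P x / T (ar * x)) \<longlongrightarrow> prob E * Gamma (\<gamma> + 1)) at_top"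
  proof (rule tendsto_sandwich)
    show "((\<lambda>x. prob E * (J (ar * x) / T (ar * x))) \<longlongrightarrow> prob E * Gamma (\<gamma> + 1)) at_top"
      by (intro tendsto_mult tendsto_const filterlim_compose[OF J_lim scale])
    have "((\<lambda>x. prob E * (J (ar * x) / T (ar * x)) + S (k * (ar * x)) / T (ar * x)) \<longlongrightarrow>
        prob E * Gamma (\<gamma> + 1) + 0) at_top"
      by (intro tendsto_add tendsto_mult tendsto_const filterlim_compose[OF J_lim scale]
          filterlim_compose[OF err_lim scale])
    then show "((\<lambda>x. prob E * (J (ar * x) / T (ar * x)) + S (k * (ar * x)) / T (ar * x)) \<longlongrightarrow>
        prob E * Gamma (\<gamma> + 1)) at_top" by simp
    show "\<forall>\<^sub>F x in at_top. prob E * (J (ar * x) / T (ar * x)) \<le> P x / T (ar * x)"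
      using eventually_gt_at_top[of 0]
    proof eventually_elim
      case (elim x)
      have "0 < T (ar * x)" using elim ar by (intro T_pos) simp
      then show ?case using divide_right_mono[OF P_bounds(1)[OF elim], of "T (ar * x)"] by simp
    qed
    show "\<forall>\<^sub>F x in at_top. P x / T (ar * x) \<le> prob E * (J (ar * x) / T (ar * x)) + S (k * (ar * x)) / T (ar * x)"
      using eventually_gt_at_top[of 0]
    proof eventually_elim
      case (elim x)
      have "0 < T (ar * x)" using elim ar by (intro T_pos) simp
      then show ?case
        using divide_right_mono[OF P_bounds(2)[OF elim], of "T (ar * x)"]
        by (simp add: add_divide_distrib S_def)
    qed
  qed
  have T_lim: "((\<lambda>y. T y / (L (1 / v y) * (S y / v y powr \<gamma>))) \<longlongrightarrow> 1) at_top"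
  proof (rule Lim_transform_eventually)
    have "filterlim (\<lambda>y. 1 / v y) (at_right 0) at_top"
      using filterlim_compose[OF filterlim_inverse_at_right_top v_inf] by (simp add: inverse_eq_divide)
    then show "((\<lambda>y. H (1 / v y) / (L (1 / v y) * (1 / v y) powr \<gamma>)) \<longlongrightarrow> 1) at_top"
      by (rule filterlim_compose[OF region(3)])
    show "\<forall>\<^sub>F y in at_top. H (1 / v y) / (L (1 / v y) * (1 / v y) powr \<gamma>) =
        T y / (L (1 / v y) * (S y / v y powr \<gamma>))"
      using eventually_gt_at_top[of 0]
    proof eventually_elim
      case (elim y)
      then show ?case
        using S_gt_0[of y] v_pos[OF elim] by (simp add: T_def powr_divide)
    qed
  qed
  have "((\<lambda>x. P x / T (ar * x) * (T (ar * x) / (L (1 / v (ar * x)) * (S (ar * x) / v (ar * x) powr \<gamma>))))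
      \<longlongrightarrow> prob E * Gamma (\<gamma> + 1) * 1) at_top"
    by (intro tendsto_mult P_lim filterlim_compose[OF T_lim scale])
  moreover have "\<forall>\<^sub>F x in at_top. P x / T (ar * x) * (T (ar * x) / (L (1 / v (ar * x)) * (S (ar * x) / v (ar * x) powr \<gamma>)))
      = P x / (L (1 / v (ar * x)) * (S (ar * x) / v (ar * x) powr \<gamma>))"
    using eventually_gt_at_top[of 0]
  proof eventually_elim
    case (elim x)
    have "0 < T (ar * x)" using elim ar by (intro T_pos) simp
    then show ?case by simp
  qed
  ultimately have "((\<lambda>x. P x / (L (1 / v (ar * x)) * (S (ar * x) / v (ar * x) powr \<gamma>)))
      \<longlongrightarrow> prob E * Gamma (\<gamma> + 1)) at_top"
    using Lim_transform_eventually by fastforce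
  moreover have "0 < Gamma (\<gamma> + 1)" using \<open>0 \<le> \<gamma>\<close> by (intro Gamma_real_pos) simp
  then have "prob E * Gamma (\<gamma> + 1) \<noteq> 0" using E_pos by simp
  ultimately have "P \<sim>[at_top] (\<lambda>x. prob E * Gamma (\<gamma> + 1) *
      (L (1 / v (ar * x)) * (S (ar * x) / v (ar * x) powr \<gamma>)))"
    by (rule asymp_equivI'_const)
  then have "P \<sim>[at_top] (\<lambda>x. prob E * Gamma (\<gamma> + 1) * L (1 / v (ar * x)) *
      ((1 - F (ar * x)) / v (ar * x) powr \<gamma>))"
    by (simp only: S_def F_eq mult.assoc)
  moreover have "ar' = ar" if "admissible a \<rho> zs ar' \<epsilon>' c'" for ar' \<epsilon>' c'
    using admissible_not_less[OF adm that a] admissible_not_less[OF that adm a] by simp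
  ultimately show ?thesis
    unfolding P_def E_def v_def Let_def by blast
qed

end
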